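(* Let $\beta\in(0,\infty)$ and let $G$ be an undirected simple graph such that either (a) $G$ is connected, finite and is not a tree, or (b) $G=\mathbb{Z}^d$ (with nearest-neighbour edges) with $d\ge 2$. Let $(X_n)_{n\in\mathbb{N}}$ be the Ant RW on $G$ with strength of reinforcement $\beta$, started from any vertex. Then $$\mathbb{P}\Big(\bigcup_{C\in\mathscr{C}}T^C\Big)=1,$$ where $\mathscr{C}$ is the set of all circuits of $G$ and $T^C$ is the event that the walk is eventually trapped in $C$.
   Context: Ant RW (directed edge reinforced random walk). Let $G=(V,E)$ be a locally finite, connected, undirected graph; write $v\sim w$ if $v,w$ form an edge. For $\beta\in(0,\infty)$ and a starting vertex $v$, the Ant RW is the $V$-valued process $(X_n)_{n\ge 0}$ with $X_0=v$ and, for $n\ge 0$ and $x\sim X_n$, $$\mathbb{P}(X_{n+1}=x\mid \mathcal{G}_n)=\frac{a_n(X_n,x)}{\sum_{y\sim X_n}a_n(X_n,y)},\qquad \mathcal{G}_n=\sigma(X_0,\dots,X_n),$$ with weights $a_n(x,y)=\exp\{\beta\,c_n(x,y)\}$ and crossing numbers $$c_n(x,y)=\sum_{k=0}^{n-1}\Big(\mathbf{1}[(X_k,X_{k+1})=(x,y)]-\mathbf{1}[(X_k,X_{k+1})=(y,x)]\Big)$$ (so $c_0\equiv 0$). Circuits. A circuit $C=(u_0,\dots,u_{\ell-1})$ of length $\ell\ge 3$ with root $u_0$ is a sequence of pairwise distinct vertices with $u_i\sim u_{i+1}$ for $0\le i\le \ell-2$ and $u_{\ell-1}\sim u_0$ (regarded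 as a closed path of directed edges). $\mathscr{C}$ is the set of all circuits. Trapping events. With $i(\ell)=i \bmod \ell$, for $m\ge 0$ set $$T^C_m=\{X_{m+i}=u_{i(\ell)}\ \text{for all } i\ge 0\},\qquad T^C=\bigcup_{m\ge 0}T^C_m.$$ *)

theory Defs
  imports "HOL-Probability.Probability" "Graph_Theory.Graph_Theory"
begin

text \<open>
  An undirected simple graph is a symmetric, loop-free \<^typ>\<open>'v pair_pre_digraph\<close>, that is, one
  satisfying \<^const>\<open>pair_bidirected_digraph\<close>: the edge between \<open>x\<close> and \<open>y\<close> is the pair of arcs
  \<open>(x, y)\<close> and \<open>(y, x)\<close>. Thus \<open>x \<sim> y\<close> is written \<open>(x, y) \<in> parcs G\<close>.
\<close>

definition neighbours :: "'v pair_pre_digraph \<Rightarrow> 'v \<Rightarrow> 'v set" where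
  "neighbours G x = {y. (x, y) \<in> parcs G}"

definition circuits :: "'v pair_pre_digraph \<Rightarrow> 'v list set" where
  "circuits G = {C. 3 \<le> length C \<and> distinct C \<and> set C \<subseteq> pverts G \<and>
     (\<forall>i. Suc i < length C \<longrightarrow> (C ! i, C ! Suc i) \<in> parcs G) \<and> (last C, hd C) \<in> parcs G}"

text \<open>
  The predicate \<^const>\<open>tree\<close> of the library is not usable for undirected graphs in this encoding,
  because there the closed walk \<open>x, y, x\<close> along a single edge counts as a cycle.
\<close>

definition undirected_tree :: "'v pair_pre_digraph \<Rightarrow> bool" where
  "undirected_tree G \<longleftrightarrow> Digraph_Component.connected (with_proj G) \<and> circuits G = {}"

definition int_lattice :: "(int ^ 'd) pair_pre_digraph" where
  "int_lattice = \<lparr>pverts = UNIV, parcs = {(x, y). (\<Sum>i\<in>UNIV. \<bar>x $ i - y $ i\<bar>) = 1}\<rparr>"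

text \<open>The crossing numbers and weights are functions of a trajectory \<open>p\<close>.\<close>

definition crossing_number :: "(nat \<Rightarrow> 'v) \<Rightarrow> nat \<Rightarrow> 'v \<Rightarrow> 'v \<Rightarrow> int" where
  "crossing_number p n x y =
     (\<Sum>k<n. of_bool ((p k, p (Suc k)) = (x, y)) - of_bool ((p k, p (Suc k)) = (y, x)))"

definition ant_weight :: "real \<Rightarrow> (nat \<Rightarrow> 'v) \<Rightarrow> nat \<Rightarrow> 'v \<Rightarrow> 'v \<Rightarrow> real" where
  "ant_weight \<beta> p n x y = exp (\<beta> * real_of_int (crossing_number p n x y))"

text \<open>The \<open>\<sigma>\<close>-algebra generated by \<open>X 0, \<dots>, X n\<close>, with discrete state space \<open>V\<close>.\<close>

definition history :: "'w measure \<Rightarrow> 'v set \<Rightarrow> (nat \<Rightarrow> 'w \<Rightarrow> 'v) \<Rightarrow> nat \<Rightarrow> 'w measure" where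
  "history M V X n = sigma (space M) {X k -` A \<inter> space M | k A. k \<le> n \<and> A \<subseteq> V}"

locale ant_rw = prob_space M
  for G :: "'v pair_pre_digraph" and \<beta> :: real and v :: 'v
    and M :: "'w measure" and X :: "nat \<Rightarrow> 'w \<Rightarrow> 'v" +
  assumes random_variable: "\<And>n. X n \<in> M \<rightarrow>\<^sub>M count_space (pverts G)"
    and start: "AE \<omega> in M. X 0 \<omega> = v"
    and transition: "\<And>n x. x \<in> pverts G \<Longrightarrow>
      AE \<omega> in M. x \<in> neighbours G (X n \<omega>) \<longrightarrow>
        real_cond_exp M (history M (pverts G) X n)
            (indicator {\<omega> \<in> space M. X (Suc n) \<omega> = x}) \<omega> =
          ant_weight \<beta> (\<lambda>k. X k \<omega>) n (X n \<omega>) x /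
            (\<Sum>y\<in>neighbours G (X n \<omega>). ant_weight \<beta> (\<lambda>k. X k \<omega>) n (X n \<omega>) y)"

definition trapped_from ::
    "'w measure \<Rightarrow> (nat \<Rightarrow> 'w \<Rightarrow> 'v) \<Rightarrow> 'v list \<Rightarrow> nat \<Rightarrow> 'w set" where
  "trapped_from M X C m = {\<omega> \<in> space M. \<forall>i. X (m + i) \<omega> = C ! (i mod length C)}"

definition trapped :: "'w measure \<Rightarrow> (nat \<Rightarrow> 'w \<Rightarrow> 'v) \<Rightarrow> 'v list \<Rightarrow> 'w set" where
  "trapped M X C = (\<Union>m. trapped_from M X C m)"

end

theory Submission
  imports Defs
begin

text \<open>
  Up to the endpoints of the path, the crossing numbers form a flow without sources, so the edges
  leaving the current vertex have crossing numbers of sum at least -1. If one of them is positive,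
  then always stepping along an edge of maximal crossing number keeps it so, never backtracks and
  never leaves the visited vertices; hence it closes a circuit. Along that circuit the crossing
  numbers are maximal, and each further round multiplies the odds of leaving it by
  \<open>exp (- \<beta>)\<close>, so with positive probability the walk never does. If none is positive, all of
  them are 0 or -1, and the walk can be steered towards a circuit and around it at a bounded cost.
  While the walk stays in a finite set both costs are bounded, so by Levy's zero-one law a walk of
  finite range is almost surely trapped.

  A walk of infinite range in the lattice sets infinitely many records in some coordinate
  direction. Each time there is a 4-circuit of fresh vertices through the current one, again
  leading to a trap with a probability bounded from below.
\<close>

subsection \<open>Crossing numbers\<close>

lemma crossing_number_0 [simp]: "crossing_number p 0 x y = 0"
  by (simp add: crossing_number_def)

lemma crossing_number_Suc:
  "crossing_number p (Suc n) x y = crossing_number p n x y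
     + (of_bool (p n = x \<and> p (Suc n) = y) - of_bool (p n = y \<and> p (Suc n) = x))"
  by (simp add: crossing_number_def)

lemma crossing_number_swap: "crossing_number p n y x = - crossing_number p n x y"
  by (induction n) (auto simp: crossing_number_Suc)

lemma crossing_number_cong:
  assumes "\<And>k. k \<le> n \<Longrightarrow> p k = q k"
  shows "crossing_number p n = crossing_number q n"
proof (intro ext)
  fix x y
  show "crossing_number p n x y = crossing_number q n x y"
    unfolding crossing_number_def using assms by (intro sum.cong) auto
qed

lemma crossing_number_mono:
  assumes "m \<le> n" "\<And>k. m \<le> k \<Longrightarrow> k < n \<Longrightarrow> \<not> (p k = y \<and> p (Suc k) = x)"
  shows "crossing_number p m x y \<le> crossing_number p n x y"
  using assms
proof (induction n rule: dec_induct)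
  case (step n)
  have "crossing_number p m x y \<le> crossing_number p n x y"
    using step.IH step.prems less_SucI by blast
  have no: "(p n = y \<and> p (Suc n) = x) = False"
    using step.prems step.hyps by blast
  have "crossing_number p n x y \<le> crossing_number p (Suc n) x y"
    unfolding crossing_number_Suc no by simp
  with \<open>crossing_number p m x y \<le> crossing_number p n x y\<close> show ?case by (rule order_trans)
qed simp

lemma crossing_number_antimono:
  assumes "m \<le> n" "\<And>k. m \<le> k \<Longrightarrow> k < n \<Longrightarrow> \<not> (p k = x \<and> p (Suc k) = y)"
  shows "crossing_number p n x y \<le> crossing_number p m x y"
proof -
  have "crossing_number p m y x \<le> crossing_number p n y x"
    using assms by (intro crossing_number_mono) auto
  then show ?thesis
    using crossing_number_swap[of p m x y] crossing_number_swap[of p n x y] by linarith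
qed

text \<open>A positive count needs an actual step from \<open>x\<close> to \<open>y\<close>. That
  step starts strictly before time \<open>n\<close>, so \<open>x\<close> is left before
  \<open>n\<close>, while \<open>y\<close> may be the position at time \<open>n\<close>
  itself.\<close>

lemma crossing_number_pos_visited:
  assumes "crossing_number p n x y > 0"
  shows "y \<in> p ` {..n}" "x \<in> p ` {..<n}"
proof -
  have "\<exists>k<n. p k = x \<and> p (Suc k) = y"
  proof (rule ccontr)
    assume "\<not> ?thesis"
    then have "crossing_number p n x y \<le> crossing_number p 0 x y"
      by (intro crossing_number_antimono) auto
    with assms show False by simp
  qed
  then obtain k where "k < n" "p k = x" "p (Suc k) = y" by blast
  then show "y \<in> p ` {..n}" "x \<in> p ` {..<n}" by (auto simp: Suc_le_eq)
qed

section \<open>Paths that run round a circuit forever\<close>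

definition follows :: "(nat \<Rightarrow> 'v) \<Rightarrow> nat \<Rightarrow> 'v list \<Rightarrow> bool" where
  "follows p m C \<longleftrightarrow> (\<forall>i. p (m + i) = C ! (i mod length C))"

lemma circuitsD:
  assumes "C \<in> circuits G"
  shows "3 \<le> length C" "distinct C" "set C \<subseteq> pverts G"
    and "i < length C \<Longrightarrow> (C ! i, C ! (Suc i mod length C)) \<in> parcs G"
proof -
  show "3 \<le> length C" "distinct C" "set C \<subseteq> pverts G"
    using assms by (auto simp: circuits_def)
  assume i: "i < length C"
  show "(C ! i, C ! (Suc i mod length C)) \<in> parcs G"
  proof (cases "Suc i = length C")
    case True
    then have "C \<noteq> []" "length C - 1 = i" by auto
    then show ?thesis using assms True by (auto simp: circuits_def last_conv_nth hd_conv_nth)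
  next
    case False
    then show ?thesis using assms i by (auto simp: circuits_def)
  qed
qed

locale circuit_path =
  fixes G :: "'v pair_pre_digraph" and p :: "nat \<Rightarrow> 'v" and m :: nat and C :: "'v list"
  assumes circuit: "C \<in> circuits G" and follows: "follows p m C"
begin

lemma length_pos: "0 < length C"
  using circuitsD(1)[OF circuit] by linarith

lemma path_nth: "p (m + i) = C ! (i mod length C)"
  using follows by (simp add: follows_def)

lemma path_arc: "(p (m + i), p (Suc (m + i))) \<in> parcs G"
  using circuitsD(4)[OF circuit, of "i mod length C"] path_nth[of i] path_nth[of "Suc i"] length_pos
  by (simp add: mod_Suc_eq)

lemma path_eq_iff: "p (m + i) = p (m + j) \<longleftrightarrow> i mod length C = j mod length C"
  unfolding path_nth using circuitsD(2)[OF circuit] length_pos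
  by (simp add: nth_eq_iff_index_eq)

text \<open>A circuit has distinct vertices, so the current vertex determines the position in the
  round and with it the next vertex.\<close>

lemma path_Suc_cong: "p (m + i) = p (m + j) \<Longrightarrow> p (Suc (m + i)) = p (Suc (m + j))"
  using path_eq_iff[of i j] path_eq_iff[of "Suc i" "Suc j"] by (simp add: mod_Suc)

text \<open>Traversing an arc of the circuit backwards would make indices that differ by two agree
  modulo the length, which is at least 3.\<close>

lemma no_reversal:
  assumes "p (m + i) = p (Suc (m + j))" "p (Suc (m + i)) = p (m + j)"
  shows False
proof -
  have "i mod length C = Suc j mod length C" "Suc i mod length C = j mod length C"
    using assms path_eq_iff[of i "Suc j"] path_eq_iff[of "Suc i" j] by simp_all
  then have "Suc (Suc j) mod length C = j mod length C"
    by (metis mod_Suc_eq)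
  then have "length C dvd Suc (Suc j) - j"
    by (simp add: mod_eq_dvd_iff_nat)
  then have "length C \<le> 2" by (auto dest!: dvd_imp_le simp: numeral_2_eq_2)
  then show False using circuitsD(1)[OF circuit] by simp
qed

text \<open>Each round crosses the arc once forwards and, by \<open>no_reversal\<close>, never
  backwards. The count is read just before the arc is crossed again, hence \<open>k\<close>
  crossings after \<open>k\<close> full rounds.\<close>

lemma crossing_number_ahead:
  "crossing_number p m (p (m + i)) (p (Suc (m + i))) + int k
     \<le> crossing_number p (m + i + k * length C) (p (m + i)) (p (Suc (m + i)))"
proof (induction k)
  case 0
  then show ?case
  proof (simp, intro crossing_number_mono)
    fix k assume "m \<le> k"
    then show "\<not> (p k = p (Suc (m + i)) \<and> p (Suc k) = p (m + i))"
      using no_reversal[of i "k - m"] by auto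
  qed simp
next
  case (Suc k)
  let ?t = "m + i + k * length C"
  let ?c = "\<lambda>t. crossing_number p t (p (m + i)) (p (Suc (m + i)))"
  have t: "p ?t = p (m + i)" using path_eq_iff[of "i + k * length C" i] by (simp add: add.assoc)
  then have t': "p (Suc ?t) = p (Suc (m + i))"
    using path_Suc_cong[of "i + k * length C" i] by (simp add: add.assoc)
  have "p (m + i) \<noteq> p (Suc (m + i))" using no_reversal[of i i] by auto
  with t t' have "?c (Suc ?t) = ?c ?t + 1" by (simp add: crossing_number_Suc)
  moreover have "?c (Suc ?t) \<le> ?c (m + i + Suc k * length C)"
  proof (intro crossing_number_mono)
    show "Suc ?t \<le> m + i + Suc k * length C" using length_pos by (simp add: Suc_le_eq)
    fix k assume "Suc ?t \<le> k"
    then have "m \<le> k" by simp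
    then show "\<not> (p k = p (Suc (m + i)) \<and> p (Suc k) = p (m + i))"
      using no_reversal[of i "k - m"] by auto
  qed
  ultimately show ?case using Suc.IH by simp
qed

lemma crossing_number_aside:
  assumes "y \<noteq> p (Suc (m + i))"
  shows "crossing_number p (m + i) (p (m + i)) y \<le> crossing_number p m (p (m + i)) y"
proof (intro crossing_number_antimono)
  fix k assume "m \<le> k"
  then show "\<not> (p k = p (m + i) \<and> p (Suc k) = y)"
    using path_Suc_cong[of "k - m" i] assms by auto
qed simp

text \<open>If the arcs of the circuit are maximal when the first round starts, every completed
  round widens their lead by one: the arc itself gains, and its competitors cannot, because the path
  never takes them.\<close>

lemma crossing_number_gap:
  assumes le: "\<And>i y. i < length C \<Longrightarrow> y \<in> neighbours G (p (m + i)) \<Longrightarrow>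
      crossing_number p m (p (m + i)) y \<le> crossing_number p m (p (m + i)) (p (Suc (m + i)))"
    and y: "y \<in> neighbours G (p (m + i))" "y \<noteq> p (Suc (m + i))"
  shows "crossing_number p (m + i) (p (m + i)) y + int (i div length C)
     \<le> crossing_number p (m + i) (p (m + i)) (p (Suc (m + i)))"
proof -
  let ?j = "i mod length C" and ?k = "i div length C"
  have eq: "p (m + ?j) = p (m + i)" using path_eq_iff[of ?j i] by simp
  then have eq': "p (Suc (m + ?j)) = p (Suc (m + i))" using path_Suc_cong by blast
  have i: "m + ?j + ?k * length C = m + i" by (simp add: algebra_simps)
  have "crossing_number p (m + i) (p (m + i)) y \<le> crossing_number p m (p (m + i)) y"
    using crossing_number_aside y(2) by simp
  also have "\<dots> \<le> crossing_number p m (p (m + i)) (p (Suc (m + i)))"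
    using le[of ?j y] length_pos y(1) eq eq' by simp
  also have "\<dots> + int ?k \<le> crossing_number p (m + i) (p (m + i)) (p (Suc (m + i)))"
    using crossing_number_ahead[of ?j ?k] eq eq' i by simp
  finally show ?thesis by simp
qed

end

section \<open>Crossing numbers as a flow\<close>

locale symmetric_graph =
  fixes G :: "'v pair_pre_digraph"
  assumes sym: "(x, y) \<in> parcs G \<Longrightarrow> (y, x) \<in> parcs G"
    and irrefl: "(x, x) \<notin> parcs G"
    and in_pverts: "(x, y) \<in> parcs G \<Longrightarrow> x \<in> pverts G"
    and finite_neighbours: "finite (neighbours G x)"
begin

text \<open>A step adds one unit of outflow at the vertex left and removes one at the vertex
  entered. Along the path these contributions telescope to its two endpoints.\<close>

lemma crossing_number_flow:
  assumes "\<And>k. k < n \<Longrightarrow> (p k, p (Suc k)) \<in> parcs G"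
  shows "(\<Sum>y\<in>neighbours G x. crossing_number p n x y) = of_bool (x = p 0) - of_bool (x = p n)"
  using assms
proof (induction n)
  case (Suc n)
  have arc: "(p n, p (Suc n)) \<in> parcs G" using Suc.prems by simp
  have out: "(\<Sum>y\<in>neighbours G x. of_bool (p n = x \<and> p (Suc n) = y)) = (of_bool (x = p n) :: int)"
  proof (cases "x = p n")
    case True
    then have "p (Suc n) \<in> neighbours G x" using arc by (simp add: neighbours_def)
    then show ?thesis using True finite_neighbours by (simp add: of_bool_def sum.delta)
  qed auto
  have inn: "(\<Sum>y\<in>neighbours G x. of_bool (p n = y \<and> p (Suc n) = x)) = (of_bool (x = p (Suc n)) :: int)"
  proof (cases "x = p (Suc n)")
    case True
    then have "p n \<in> neighbours G x" using arc sym by (simp add: neighbours_def)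
    then show ?thesis using True finite_neighbours by (simp add: of_bool_def sum.delta)
  qed auto
  show ?case unfolding crossing_number_Suc sum.distrib sum_subtractf out inn
    using Suc by simp
qed simp

end

subsection \<open>Steering towards a circuit\<close>

text \<open>The slack \<open>d\<close> measures how costly the step at time \<open>k\<close> is: 0
  means that the step is maximal, and a negative value means that it beats every competitor by at
  least \<open>- d\<close>.\<close>

definition step_slack :: "'v pair_pre_digraph \<Rightarrow> (nat \<Rightarrow> 'v) \<Rightarrow> nat \<Rightarrow> int \<Rightarrow> bool" where
  "step_slack G p k d \<longleftrightarrow> (\<forall>y\<in>neighbours G (p k). y \<noteq> p (Suc k) \<longrightarrow>
     crossing_number p k (p k) y \<le> crossing_number p k (p k) (p (Suc k)) + d)"

text \<open>Maximality of the arcs is demanded only for the crossing numbers at time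
  \<open>m\<close>; at all later times it follows from \<open>crossing_number_gap\<close>.\<close>

definition greedy_circuit :: "'v pair_pre_digraph \<Rightarrow> (nat \<Rightarrow> 'v) \<Rightarrow> nat \<Rightarrow> 'v list \<Rightarrow> bool" where
  "greedy_circuit G p m C \<longleftrightarrow> C \<in> circuits G \<and> follows p m C \<and>
     (\<forall>i<length C. \<forall>y\<in>neighbours G (p (m + i)).
        crossing_number p m (p (m + i)) y \<le> crossing_number p m (p (m + i)) (p (Suc (m + i))))"

lemma step_slack_cong:
  assumes "\<And>i. i \<le> Suc k \<Longrightarrow> p i = q i"
  shows "step_slack G p k d \<longleftrightarrow> step_slack G q k d"
proof -
  have "crossing_number p k = crossing_number q k"
    using assms by (intro crossing_number_cong) simp
  then show ?thesis using assms[of k] assms[of "Suc k"] by (simp add: step_slack_def)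
qed

lemma greedy_circuit_step_slack:
  assumes "greedy_circuit G p m C"
  shows "step_slack G p (m + i) (- int (i div length C))"
proof -
  interpret circuit_path G p m C
    using assms by unfold_locales (auto simp: greedy_circuit_def)
  show ?thesis unfolding step_slack_def
    using crossing_number_gap[of _ i] assms unfolding greedy_circuit_def by fastforce
qed

context symmetric_graph
begin

abbreviation is_path :: "(nat \<Rightarrow> 'v) \<Rightarrow> nat \<Rightarrow> bool" where
  "is_path p n \<equiv> \<forall>k<n. (p k, p (Suc k)) \<in> parcs G"

text \<open>The total outflow of \<open>x\<close> is at least -1 by
  \<open>crossing_number_flow\<close>. The terms other than that of \<open>z\<close> are at most 0,
  so \<open>z\<close> carries at least this total.\<close>

lemma crossing_number_lower:
  assumes "is_path p n" "z \<in> neighbours G x"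
    and "\<And>y. y \<in> neighbours G x \<Longrightarrow> crossing_number p n x y \<le> 0"
  shows "- 1 \<le> crossing_number p n x z"
proof -
  have "- 1 \<le> (\<Sum>y\<in>neighbours G x. crossing_number p n x y)"
    using assms(1) by (subst crossing_number_flow) auto
  also have "\<dots> = crossing_number p n x z + (\<Sum>y\<in>neighbours G x - {z}. crossing_number p n x y)"
    using assms(2) finite_neighbours by (simp add: sum.remove)
  also have "\<dots> \<le> crossing_number p n x z + 0"
    using assms(3) by (intro add_left_mono sum_nonpos) auto
  finally show ?thesis by simp
qed

text \<open>This is what forbids backtracking: after a step along an edge with crossing number at
  least 1, the way back has crossing number at most -2.\<close>

lemma crossing_number_reverse_Suc:
  assumes "(p n, p (Suc n)) \<in> parcs G"
  shows "crossing_number p (Suc n) (p (Suc n)) (p n) = - crossing_number p n (p n) (p (Suc n)) - 1"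
proof -
  have "p n \<noteq> p (Suc n)" using irrefl assms by metis
  then show ?thesis
    using crossing_number_swap[of p "Suc n" "p n" "p (Suc n)"] by (simp add: crossing_number_Suc)
qed

text \<open>A step along an edge of positive crossing number leaves a flow of at least 2 into the
  new vertex, at most one unit of which can end there.\<close>

lemma positive_continuation:
  assumes "is_path p (Suc n)" "1 \<le> crossing_number p n (p n) (p (Suc n))"
  shows "\<exists>y\<in>neighbours G (p (Suc n)). 1 \<le> crossing_number p (Suc n) (p (Suc n)) y"
proof (rule ccontr)
  assume "\<not> ?thesis"
  then have "crossing_number p (Suc n) (p (Suc n)) y \<le> 0" if "y \<in> neighbours G (p (Suc n))" for y
    using that by force
  moreover have "p n \<in> neighbours G (p (Suc n))"
    using assms(1) sym unfolding neighbours_def by blast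
  ultimately have "- 1 \<le> crossing_number p (Suc n) (p (Suc n)) (p n)"
    using assms(1) by (intro crossing_number_lower)
  then show False using crossing_number_reverse_Suc[of p n] assms by simp
qed

text \<open>The invariant is that some edge leaving the current vertex is positive. The maximal edge
  is then positive too, and stepping along it restores the invariant by
  \<open>positive_continuation\<close>.\<close>

lemma greedy_extension:
  assumes "is_path p n" "y0 \<in> neighbours G (p n)" "1 \<le> crossing_number p n (p n) y0"
  shows "\<exists>q. (\<forall>k\<le>n. q k = p k) \<and> is_path q (n + j) \<and>
    (\<forall>k. n \<le> k \<longrightarrow> k < n + j \<longrightarrow> 1 \<le> crossing_number q k (q k) (q (Suc k)) \<and> step_slack G q k 0) \<and>
    (\<exists>y\<in>neighbours G (q (n + j)). 1 \<le> crossing_number q (n + j) (q (n + j)) y)"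
proof (induction j)
  case 0
  show ?case using assms by (intro exI[of _ p]) auto
next
  case (Suc j)
  then obtain q y where q: "\<forall>k\<le>n. q k = p k" "is_path q (n + j)"
      "\<And>k. n \<le> k \<Longrightarrow> k < n + j \<Longrightarrow> 1 \<le> crossing_number q k (q k) (q (Suc k)) \<and> step_slack G q k 0"
      "y \<in> neighbours G (q (n + j))" "1 \<le> crossing_number q (n + j) (q (n + j)) y"
    by blast
  define f where "f = crossing_number q (n + j) (q (n + j))"
  have "Max (f ` neighbours G (q (n + j))) \<in> f ` neighbours G (q (n + j))"
    using finite_neighbours q(4) by (intro Max_in) auto
  then obtain z where z: "z \<in> neighbours G (q (n + j))" "f z = Max (f ` neighbours G (q (n + j)))"
    by (metis imageE)
  have le: "f x \<le> f z" if "x \<in> neighbours G (q (n + j))" for x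
    unfolding z(2) using that finite_neighbours by (intro Max_ge) auto
  define r where "r = q(Suc (n + j) := z)"
  have rq: "r k = q k" if "k \<le> n + j" for k using that by (simp add: r_def)
  have rz: "r (Suc (n + j)) = z" by (simp add: r_def)
  have cr: "crossing_number r k = crossing_number q k" if "k \<le> n + j" for k
    using that rq by (intro crossing_number_cong) simp
  have path: "is_path r (Suc (n + j))"
  proof (intro allI impI)
    fix k assume "k < Suc (n + j)"
    then consider "k < n + j" | "k = n + j" by linarith
    then show "(r k, r (Suc k)) \<in> parcs G"
    proof cases
      case 1 then show ?thesis using q(2) rq by simp
    next
      case 2 then show ?thesis using z(1) rq rz by (simp add: neighbours_def)
    qed
  qed
  have one: "1 \<le> crossing_number r (n + j) (r (n + j)) (r (Suc (n + j)))"
    using le[OF q(4)] q(5) rz rq cr by (simp add: f_def)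
  have "1 \<le> crossing_number r k (r k) (r (Suc k)) \<and> step_slack G r k 0"
    if k: "n \<le> k" "k < n + Suc j" for k
  proof (cases "k < n + j")
    case True
    then show ?thesis using q(3)[of k] k rq cr step_slack_cong[of k r q G 0] by simp
  next
    case False
    with k have [simp]: "k = n + j" by simp
    have "step_slack G r (n + j) 0"
      using le rz rq cr by (simp add: step_slack_def f_def)
    then show ?thesis using one by simp
  qed
  moreover obtain y' where "y' \<in> neighbours G (r (Suc (n + j)))"
      "1 \<le> crossing_number r (Suc (n + j)) (r (Suc (n + j))) y'"
    using positive_continuation[OF path one] by blast
  ultimately show ?case using path q(1) rq by (intro exI[of _ r]) auto
qed

text \<open>Positive edges lead only to visited vertices, of which there are \<open>R\<close>, so
  \<open>R\<close> greedy steps must repeat a vertex. The first repetition closes a cycle; without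
  loops and backtracking its length is at least 3.\<close>

lemma greedy_closes_circuit:
  fixes p :: "nat \<Rightarrow> 'v" and n :: nat
  defines "R \<equiv> card (p ` {..n})"
  assumes path: "is_path p (n + R)"
    and greedy: "\<And>k. n \<le> k \<Longrightarrow> k < n + R \<Longrightarrow>
      1 \<le> crossing_number p k (p k) (p (Suc k)) \<and> step_slack G p k 0"
  shows "\<exists>q m C. n \<le> m \<and> m \<le> n + R \<and> length C \<le> R \<and> (\<forall>k\<le>m. q k = p k) \<and> greedy_circuit G q m C"
proof -
  \<comment> \<open>The vertex entered at time \<open>n + j\<close> already occurred at an earlier
    time; strong induction moves that time back to at most \<open>n\<close>.\<close>
  have visited: "p (n + j) \<in> p ` {..n}" if "j \<le> R" for j
    using that
  proof (induction j rule: less_induct)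
    case (less j)
    show ?case
    proof (cases j)
      case (Suc i)
      have "0 < crossing_number p (n + i) (p (n + i)) (p (Suc (n + i)))"
        using greedy[of "n + i"] less.prems Suc by simp
      then obtain k where k: "k \<le> n + i" "p (n + j) = p k"
        using crossing_number_pos_visited(1) Suc by fastforce
      show ?thesis
      proof (cases "k \<le> n")
        case False
        then show ?thesis using less.IH[of "k - n"] less.prems k Suc by simp
      qed (use k in auto)
    qed simp
  qed
  have "\<not> inj_on p {n..n + R}"
  proof
    assume "inj_on p {n..n + R}"
    then have "card {n..n + R} = card (p ` {n..n + R})" by (simp add: card_image)
    also have "\<dots> \<le> R" unfolding R_def
    proof (intro card_mono)
      show "p ` {n..n + card (p ` {..n})} \<subseteq> p ` {..n}"
        using visited unfolding R_def by (force simp: le_iff_add)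
    qed simp
    finally show False by simp
  qed
  then obtain a0 b0 where "n \<le> a0" "a0 < b0" "b0 \<le> n + R" "p a0 = p b0"
    unfolding inj_on_def by (metis atLeastAtMost_iff nat_neq_iff)
  \<comment> \<open>Taking the least \<open>b\<close> at which a vertex repeats makes
    \<open>p\<close> injective on the times from \<open>n\<close> up to but excluding
    \<open>b\<close>.\<close>
  define P where "P b \<longleftrightarrow> (\<exists>a. n \<le> a \<and> a < b \<and> p a = p b)" for b
  define b where "b = (LEAST b. P b)"
  have "P b0" using \<open>n \<le> a0\<close> \<open>a0 < b0\<close> \<open>p a0 = p b0\<close> by (auto simp: P_def)
  then have "P b" "b \<le> b0" unfolding b_def by (auto intro: LeastI Least_le)
  then obtain a where a: "n \<le> a" "a < b" "p a = p b" by (auto simp: P_def)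
  have b: "b \<le> n + R" using \<open>b \<le> b0\<close> \<open>b0 \<le> n + R\<close> by simp
  have not_P: "\<not> P k" if "k < b" for k using that not_less_Least unfolding b_def by blast
  have inj: "i = j" if "p i = p j" "n \<le> i" "n \<le> j" "i < b" "j < b" for i j
    using not_P[of i] not_P[of j] that unfolding P_def by (metis nat_neq_iff)
  have no_backtrack: "p (Suc (Suc k)) \<noteq> p k" if k: "n \<le> k" "Suc k < n + R" for k
  proof
    assume eq: "p (Suc (Suc k)) = p k"
    have "1 \<le> crossing_number p k (p k) (p (Suc k))" 
      "1 \<le> crossing_number p (Suc k) (p (Suc k)) (p (Suc (Suc k)))"
      using greedy[of k] greedy[of "Suc k"] k by simp_all
    then show False
      using crossing_number_reverse_Suc[of p k] path k eq by simp
  qed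
  have arc: "(p k, p (Suc k)) \<in> parcs G" if "k < b" for k using path b that by simp
  define C where "C = map p [a..<b]"
  define l where "l = b - a"
  have len: "length C = l" by (simp add: C_def l_def)
  have nth: "C ! i = p (a + i)" if "i < l" for i using that by (simp add: C_def l_def)
  have l: "3 \<le> l"
  proof -
    have "b \<noteq> Suc a" using arc[of a] irrefl a by metis
    moreover have "b \<noteq> Suc (Suc a)" using no_backtrack[of a] a b by auto
    ultimately show ?thesis using a unfolding l_def by linarith
  qed
  have nth_Suc: "C ! (Suc i mod l) = p (Suc (a + i))" if "i < l" for i
  proof (cases "Suc i = l")
    case True
    then have "Suc (a + i) = b" using a by (simp add: l_def)
    then show ?thesis using True nth[of 0] l a by simp
  qed (use that nth[of "Suc i"] in auto)
  have distinct: "distinct C"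
    unfolding C_def distinct_map using inj a by (auto simp: inj_on_def)
  have circuit: "C \<in> circuits G"
    unfolding circuits_def
  proof (intro CollectI conjI allI impI)
    show "3 \<le> length C" using l len by simp
    show "set C \<subseteq> pverts G" using arc in_pverts by (force simp: C_def)
    show "(last C, hd C) \<in> parcs G"
    proof -
      have "C \<noteq> []" using len l by auto
      then have "last C = p (a + (l - 1))" "hd C = p a"
        using len nth[of "l - 1"] nth[of 0] l by (simp_all add: last_conv_nth hd_conv_nth)
      moreover have "Suc (a + (l - 1)) = b" using l a by (simp add: l_def)
      ultimately show ?thesis using arc[of "a + (l - 1)"] a by auto
    qed
    fix i assume "Suc i < length C"
    then show "(C ! i, C ! Suc i) \<in> parcs G"
      using arc[of "a + i"] nth[of i] nth[of "Suc i"] len by (simp add: l_def)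
  qed (rule distinct)
  have "length C = card (set C)" using distinct by (simp add: distinct_card)
  also have "\<dots> \<le> R" unfolding R_def
  proof (intro card_mono)
    have "p k \<in> p ` {..n}" if "a \<le> k" "k < b" for k
      using visited[of "k - n"] that a b by simp
    then show "set C \<subseteq> p ` {..n}" by (auto simp: C_def)
  qed simp
  finally have lenR: "length C \<le> R" .
  \<comment> \<open>At time \<open>b\<close> the path is back at \<open>p a\<close>, the root of
    \<open>C\<close>; from then on \<open>q\<close> keeps going round.\<close>
  define q where "q k = (if k \<le> b then p k else C ! ((k - b) mod l))" for k
  have follows: "follows q b C"
    unfolding follows_def
  proof
    fix i
    show "q (b + i) = C ! (i mod length C)"
      using nth[of 0] l a len by (cases "i = 0") (simp_all add: q_def)
  qed
  have cq: "crossing_number q b = crossing_number p b"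
    by (intro crossing_number_cong) (simp add: q_def)
  have "crossing_number q b (q (b + i)) y \<le> crossing_number q b (q (b + i)) (q (Suc (b + i)))"
    if i: "i < length C" and y: "y \<in> neighbours G (q (b + i))" for i y
  proof (cases "y = q (Suc (b + i))")
    case False
    have x: "q (b + i) = p (a + i)"
      using follows i nth len by (simp add: follows_def)
    have nx: "q (Suc (b + i)) = p (Suc (a + i))"
      using follows[unfolded follows_def, rule_format, of "Suc i"] i nth_Suc len by simp
    have ai: "n \<le> a + i" "a + i < b" using i len a by (auto simp: l_def)
    \<comment> \<open>The arc was maximal when it was taken at time \<open>a + i\<close>. Up to time
      \<open>b\<close> its tail is not left again, so a competitor \<open>y\<close> cannot gain, and
      the arc is not crossed backwards, so it cannot lose.\<close>
    have "crossing_number p b (p (a + i)) y \<le> crossing_number p (a + i) (p (a + i)) y"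
    proof (intro crossing_number_antimono)
      fix k assume k: "a + i \<le> k" "k < b"
      then show "\<not> (p k = p (a + i) \<and> p (Suc k) = y)"
        using inj[of k "a + i"] ai False nx by auto
    qed (use ai in simp)
    also have "\<dots> \<le> crossing_number p (a + i) (p (a + i)) (p (Suc (a + i)))"
      using greedy[of "a + i"] ai b y x False nx by (simp add: step_slack_def)
    also have "\<dots> \<le> crossing_number p b (p (a + i)) (p (Suc (a + i)))"
    proof (intro crossing_number_mono)
      fix k assume k: "a + i \<le> k" "k < b"
      show "\<not> (p k = p (Suc (a + i)) \<and> p (Suc k) = p (a + i))"
      proof
        assume eq: "p k = p (Suc (a + i)) \<and> p (Suc k) = p (a + i)"
        \<comment> \<open>A reversal inside the cycle would be an immediate backtrack. For the last
          arc, which enters \<open>p b = p a\<close>, injectivity gives \<open>k = a\<close>, so the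
          cycle would have length 1.\<close>
        show False
        proof (cases "Suc (a + i) < b")
          case True
          then have "k = Suc (a + i)" using inj[of k "Suc (a + i)"] eq k ai by simp
          then show False using no_backtrack[of "a + i"] eq k ai b by simp
        next
          case False
          then have "Suc (a + i) = b" using ai by simp
          then have "k = a" using inj[of k a] eq k ai a by simp
          then show False using k \<open>Suc (a + i) = b\<close> l by (simp add: l_def)
        qed
      qed
    qed (use ai in simp)
    finally show ?thesis unfolding cq x nx .
  qed simp
  then have "greedy_circuit G q b C"
    using circuit follows by (simp add: greedy_circuit_def)
  then show ?thesis
    using a b lenR by (intro exI[of _ q] exI[of _ b] exI[of _ C]) (auto simp: q_def)
qed

text \<open>As long as no edge is positive, the first arc of the circuit has crossing number at
  least -1 when the circuit is entered. Two rounds raise it to at least 1, whence the factor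
  2.\<close>

lemma positive_on_circuit:
  assumes path: "is_path p (n + d)" and C: "C \<in> circuits G" "follows p (n + d) C"
  shows "\<exists>k y. n \<le> k \<and> k \<le> n + (d + 2 * length C) \<and>
    y \<in> neighbours G (p k) \<and> 1 \<le> crossing_number p k (p k) y"
proof (rule ccontr)
  assume neg: "\<not> ?thesis"
  let ?t = "n + d"
  interpret circuit_path G p ?t C using C by unfold_locales
  have nb: "p (Suc ?t) \<in> neighbours G (p ?t)"
    using path_arc[of 0] by (simp add: neighbours_def)
  have "- 1 \<le> crossing_number p ?t (p ?t) (p (Suc ?t))"
  proof (rule crossing_number_lower[OF path nb])
    fix y assume "y \<in> neighbours G (p ?t)"
    then show "crossing_number p ?t (p ?t) y \<le> 0"
      using neg by (metis le_add1 add_le_mono le_refl not_le zle_add1_eq_le add_0 add.commute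
          int_one_le_iff_zero_less)
  qed
  moreover have "crossing_number p ?t (p ?t) (p (Suc ?t)) + 2
      \<le> crossing_number p (?t + 2 * length C) (p ?t) (p (Suc ?t))"
    using crossing_number_ahead[of 0 2] by simp
  ultimately have "1 \<le> crossing_number p (?t + 2 * length C) (p ?t) (p (Suc ?t))" by simp
  moreover have "p (?t + 2 * length C) = p ?t" using path_eq_iff[of "2 * length C" 0] by simp
  ultimately show False
    using neg nb by (metis add.assoc le_add1 le_refl)
qed

text \<open>As long as no edge leaving the current vertex has a positive crossing number, all of them
  have crossing number 0 or -1, so the walk can be steered towards a circuit and around it, which
  eventually does create a positive crossing number. From then on it can be greedy.\<close>

lemma greedy_circuit_extension:
  fixes p w :: "nat \<Rightarrow> 'v" and n d :: nat and C0 :: "'v list"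
  defines "L \<equiv> d + 2 * length C0"
  assumes path: "is_path p n"
    and w: "w 0 = p n" "\<And>k. (w k, w (Suc k)) \<in> parcs G" "C0 \<in> circuits G" "follows w d C0"
  shows "\<exists>q m C. (\<forall>k\<le>n. q k = p k) \<and> (\<forall>k. (q k, q (Suc k)) \<in> parcs G) \<and>
    n \<le> m \<and> m \<le> n + 2 * L + card (p ` {..n}) \<and> length C \<le> L + card (p ` {..n}) \<and>
    (\<forall>k. n \<le> k \<longrightarrow> k < m \<longrightarrow> step_slack G q k 1) \<and> greedy_circuit G q m C"
proof -
  define p1 where "p1 k = (if k \<le> n then p k else w (k - n))" for k
  have p1_w: "p1 (n + k) = w k" for k using w(1) by (simp add: p1_def)
  have path1: "is_path p1 N" for N
  proof (intro allI impI)
    fix k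
    show "(p1 k, p1 (Suc k)) \<in> parcs G"
    proof (cases "k < n")
      case True
      then show ?thesis using path by (simp add: p1_def)
    next
      case False
      then show ?thesis using w(2)[of "k - n"] p1_w[of "k - n"] p1_w[of "Suc (k - n)"] by simp
    qed
  qed
  have "follows p1 (n + d) C0"
    using w(4) unfolding follows_def add.assoc p1_w by simp
  note pos = positive_on_circuit[OF path1 w(3) this]
  define P where "P k \<longleftrightarrow> n \<le> k \<and> (\<exists>y\<in>neighbours G (p1 k). 1 \<le> crossing_number p1 k (p1 k) y)" for k
  from pos obtain k0 where k0: "P k0" "k0 \<le> n + L" unfolding P_def L_def by blast
  define n1 where "n1 = (LEAST k. P k)"
  have "P n1" unfolding n1_def using k0(1) by (rule LeastI)
  have n1: "n \<le> n1" "n1 \<le> n + L"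
    using \<open>P n1\<close> Least_le[of P, OF k0(1)] k0(2) by (simp_all add: P_def n1_def)
  obtain y0 where y0: "y0 \<in> neighbours G (p1 n1)" "1 \<le> crossing_number p1 n1 (p1 n1) y0"
    using \<open>P n1\<close> unfolding P_def by blast
  have slack1: "step_slack G p1 k 1" if k: "n \<le> k" "k < n1" for k
  proof -
    have "\<not> P k" using k(2) not_less_Least unfolding n1_def by blast
    then have le0: "crossing_number p1 k (p1 k) y \<le> 0" if "y \<in> neighbours G (p1 k)" for y
      using that k(1) unfolding P_def by force
    moreover have "- 1 \<le> crossing_number p1 k (p1 k) (p1 (Suc k))"
      using path1[of "Suc k"] by (intro crossing_number_lower path1 le0) (simp_all add: neighbours_def)
    ultimately show ?thesis unfolding step_slack_def by fastforce
  qed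
  define R where "R = card (p1 ` {..n1})"
  \<comment> \<open>At most \<open>L\<close> new vertices are met between \<open>n\<close> and
    \<open>n1\<close>. Together with \<open>n1 \<le> n + L\<close> and \<open>m \<le> n1 + R\<close>
    this yields the bound on \<open>m\<close>.\<close>
  have R: "R \<le> L + card (p ` {..n})"
  proof -
    have "p1 ` {..n1} \<subseteq> p ` {..n} \<union> p1 ` {n<..n1}"
      by (auto simp: p1_def)
    then have "R \<le> card (p ` {..n} \<union> p1 ` {n<..n1})"
      unfolding R_def by (intro card_mono) auto
    also have "\<dots> \<le> card (p ` {..n}) + card (p1 ` {n<..n1})" by (rule card_Un_le)
    also have "\<dots> \<le> card (p ` {..n}) + card {n<..n1}" by (intro add_left_mono card_image_le) simp
    finally show ?thesis using n1 by simp
  qed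
  obtain p2 where p2: "\<forall>k\<le>n1. p2 k = p1 k" "is_path p2 (n1 + R)"
    "\<And>k. n1 \<le> k \<Longrightarrow> k < n1 + R \<Longrightarrow> 1 \<le> crossing_number p2 k (p2 k) (p2 (Suc k)) \<and> step_slack G p2 k 0"
    using greedy_extension[OF path1 y0, of R] by blast
  have Req: "card (p2 ` {..n1}) = R"
    unfolding R_def using p2(1) by (intro arg_cong[of _ _ card] image_cong) auto
  obtain q m C where q: "n1 \<le> m" "m \<le> n1 + R" "length C \<le> R" "\<And>k. k \<le> m \<Longrightarrow> q k = p2 k"
    "greedy_circuit G q m C"
    using greedy_closes_circuit[where p = p2 and n = n1, unfolded Req, OF p2(2,3)] by blast
  have qp1: "q k = p1 k" if "k \<le> n1" for k using q(1,4) p2(1) that by simp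
  interpret Q: circuit_path G q m C
    using q(5) by unfold_locales (auto simp: greedy_circuit_def)
  have "(q k, q (Suc k)) \<in> parcs G" for k
  proof (cases "k < m")
    case True
    then show ?thesis using q(2,4) p2(2) by simp
  next
    case False
    then show ?thesis using Q.path_arc[of "k - m"] by simp
  qed
  moreover have "step_slack G q k 1" if k: "n \<le> k" "k < m" for k
  proof (cases "k < n1")
    case True
    then show ?thesis using slack1[OF k(1)] step_slack_cong[of k q p1 G 1] qp1 by simp
  next
    case False
    then have "step_slack G q k 0"
      using p2(3)[of k] step_slack_cong[of k q p2 G 0] q(2,4) k by simp
    then show ?thesis unfolding step_slack_def by fastforce
  qed
  moreover have "q k = p k" if "k \<le> n" for k using qp1[of k] n1 that by (simp add: p1_def)
  ultimately show ?thesis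
    using q n1 R by (intro exI[of _ q] exI[of _ m] exI[of _ C]) auto
qed

text \<open>No vertex of \<open>C\<close> was left before time \<open>n\<close>, so no edge out of
  one is positive. The arcs of \<open>C\<close> are not negative either, since a negative one would
  have been crossed from its head, also a vertex of \<open>C\<close>.\<close>

lemma fresh_greedy_circuit:
  assumes C: "C \<in> circuits G" "follows p n C" and fresh: "set C \<inter> p ` {..<n} = {}"
  shows "greedy_circuit G p n C"
proof -
  interpret circuit_path G p n C using C by unfold_locales
  have notin: "p (n + i) \<notin> p ` {..<n}" for i
  proof -
    have "p (n + i) \<in> set C" using path_nth[of i] length_pos by simp
    then show ?thesis using fresh by blast
  qed
  have "crossing_number p n (p (n + i)) y \<le> 0" for i y
    using crossing_number_pos_visited(2)[of p n "p (n + i)" y] notin[of i] by force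
  moreover have "0 \<le> crossing_number p n (p (n + i)) (p (Suc (n + i)))" for i
    using crossing_number_pos_visited(2)[of p n "p (Suc (n + i))" "p (n + i)"] notin[of "Suc i"]
      crossing_number_swap[of p n "p (n + i)" "p (Suc (n + i))"] by force
  ultimately show ?thesis using C unfolding greedy_circuit_def by (meson order_trans)
qed

end

subsection \<open>A zero-one law for countable state spaces\<close>

context prob_space
begin

text \<open>Cylinders are the atoms of the history up to time \<open>n\<close>; conditional
  probabilities given the history become ratios of probabilities of such sets.\<close>

definition cylinder :: "(nat \<Rightarrow> 'a \<Rightarrow> 'v) \<Rightarrow> (nat \<Rightarrow> 'v) \<Rightarrow> nat \<Rightarrow> 'a set" where
  "cylinder X p n = {\<omega> \<in> space M. \<forall>k\<le>n. X k \<omega> = p k}"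

lemma cylinder_cong: "(\<And>k. k \<le> n \<Longrightarrow> p k = q k) \<Longrightarrow> cylinder X p n = cylinder X q n"
  by (auto simp: cylinder_def)

lemma cylinder_antimono: "m \<le> n \<Longrightarrow> cylinder X p n \<subseteq> cylinder X p m"
  by (auto simp: cylinder_def)

context
  fixes V :: "'v set" and X :: "nat \<Rightarrow> 'a \<Rightarrow> 'v"
  assumes V: "countable V" and X: "\<And>n. X n \<in> M \<rightarrow>\<^sub>M count_space V"
begin

lemma eq_sets: "{\<omega> \<in> space M. X n \<omega> = x} \<in> sets M"
proof (cases "x \<in> V")
  case True
  then have "X n -` {x} \<inter> space M \<in> sets M" using X by (intro measurable_sets[OF X]) simp
  then show ?thesis by (simp add: vimage_def Int_def conj_commute)
next
  case False
  then have "{\<omega> \<in> space M. X n \<omega> = x} = {}" using measurable_space[OF X] by fastforce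
  then show ?thesis by (simp only: sets.empty_sets)
qed

lemma cylinder_sets: "cylinder X p n \<in> sets M"
proof -
  have "cylinder X p n = (\<Inter>k\<le>n. {\<omega> \<in> space M. X k \<omega> = p k})"
    by (auto simp: cylinder_def)
  then show ?thesis using eq_sets by auto
qed

lemma countable_cylinders: "countable {cylinder X (\<lambda>k. X k \<omega>) n | \<omega> n. \<omega> \<in> space M}"
proof (rule countable_subset)
  let ?f = "\<lambda>xs. {\<omega> \<in> space M. \<forall>k<length xs. X k \<omega> = xs ! k}"
  show "{cylinder X (\<lambda>k. X k \<omega>) n | \<omega> n. \<omega> \<in> space M} \<subseteq> ?f ` lists V"
  proof clarify
    fix \<omega> n assume \<omega>: "\<omega> \<in> space M"
    have "map (\<lambda>k. X k \<omega>) [0..<Suc n] \<in> lists V"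
      using measurable_space[OF X \<omega>] by auto
    moreover have "cylinder X (\<lambda>k. X k \<omega>) n = ?f (map (\<lambda>k. X k \<omega>) [0..<Suc n])"
      by (auto simp: cylinder_def less_Suc_eq_le simp del: upt_Suc)
    ultimately show "cylinder X (\<lambda>k. X k \<omega>) n \<in> ?f ` lists V" by blast
  qed
qed (use V in auto)

text \<open>The cylinders around \<open>A\<close> that are minimal with \<open>P\<close> are pairwise disjoint.\<close>

lemma cylinder_cover:
  assumes "\<And>C. P C \<Longrightarrow> \<delta> * prob C \<le> prob (T \<inter> C)" "T \<in> sets M" "0 < \<delta>"
    and A: "A \<subseteq> space M" "\<And>\<omega>. \<omega> \<in> A \<Longrightarrow> \<exists>n. P (cylinder X (\<lambda>k. X k \<omega>) n)"
    and U: "\<And>C. P C \<Longrightarrow> C \<subseteq> U" "U \<in> sets M"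
  shows "\<exists>B\<in>sets M. A \<subseteq> B \<and> prob B \<le> prob (T \<inter> U) / \<delta>"
proof -
  let ?cyl = "\<lambda>\<omega> n. cylinder X (\<lambda>k. X k \<omega>) n"
  define \<tau> where "\<tau> \<omega> = (LEAST n. P (?cyl \<omega> n))" for \<omega>
  \<comment> \<open>The set \<open>A\<close> is not assumed measurable. The union of the countable
    family \<open>H\<close> is its measurable cover.\<close>
  define H where "H = (\<lambda>\<omega>. ?cyl \<omega> (\<tau> \<omega>)) ` A"
  have P: "P (?cyl \<omega> (\<tau> \<omega>))" if "\<omega> \<in> A" for \<omega>
    using A(2)[OF that] unfolding \<tau>_def by (rule LeastI_ex)
  have H_P: "P C" if "C \<in> H" for C using that P by (auto simp: H_def)
  have H_sets: "C \<in> sets M" if "C \<in> H" for C using that cylinder_sets by (auto simp: H_def)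
  have H_countable: "countable H"
    by (rule countable_subset[OF _ countable_cylinders]) (use A(1) in \<open>auto simp: H_def\<close>)
  have eq: "?cyl \<omega> n = ?cyl \<omega>' n" if "\<omega>' \<in> ?cyl \<omega> m" "n \<le> m" for \<omega> \<omega>' n m
    using that by (intro cylinder_cong) (simp add: cylinder_def)
  \<comment> \<open>A point of a minimal cylinder shares its initial segment, hence also the first
    time at which \<open>P\<close> holds. Two minimal cylinders that meet are therefore
    equal.\<close>
  have "?cyl \<omega> (\<tau> \<omega>) = ?cyl \<omega>' (LEAST n. P (?cyl \<omega>' n))"
    if "\<omega> \<in> A" "\<omega>' \<in> ?cyl \<omega> (\<tau> \<omega>)" for \<omega> \<omega>'
  proof -
    have "(LEAST n. P (?cyl \<omega>' n)) = \<tau> \<omega>"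
    proof (rule Least_equality)
      show "P (?cyl \<omega>' (\<tau> \<omega>))" using P[OF that(1)] eq[OF that(2)] by simp
      fix n assume n: "P (?cyl \<omega>' n)"
      show "\<tau> \<omega> \<le> n"
      proof (rule ccontr)
        assume "\<not> \<tau> \<omega> \<le> n"
        then have "P (?cyl \<omega> n)" "n < \<tau> \<omega>" using n eq[OF that(2), of n] by simp_all
        then show False using not_less_Least unfolding \<tau>_def by blast
      qed
    qed
    then show ?thesis using eq[OF that(2)] by simp
  qed
  then have disj: "disjoint_family_on (\<lambda>C. C) H"
    unfolding disjoint_family_on_def H_def by (smt (verit, best) disjoint_iff imageE)
  have "ennreal \<delta> * emeasure M (\<Union>H) = ennreal \<delta> * (\<integral>\<^sup>+C. emeasure M C \<partial>count_space H)"
    using emeasure_UN_countable[OF _ H_countable disj, of M] H_sets by simp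
  also have "\<dots> = (\<integral>\<^sup>+C. ennreal \<delta> * emeasure M C \<partial>count_space H)"
    by (simp add: nn_integral_cmult)
  also have "\<dots> \<le> (\<integral>\<^sup>+C. emeasure M (T \<inter> C) \<partial>count_space H)"
  proof (intro nn_integral_mono)
    fix C assume "C \<in> space (count_space H)"
    then have "\<delta> * prob C \<le> prob (T \<inter> C)" using assms(1) H_P by simp
    then show "ennreal \<delta> * emeasure M C \<le> emeasure M (T \<inter> C)"
      using assms(3) by (simp add: emeasure_eq_measure ennreal_mult[symmetric] ennreal_leI)
  qed
  also have "\<dots> = emeasure M (\<Union>C\<in>H. T \<inter> C)"
    using disj assms(2) H_sets
    by (intro emeasure_UN_countable[symmetric] H_countable) (auto simp: disjoint_family_on_def)
  also have "\<dots> \<le> emeasure M (T \<inter> U)"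
    using assms(2) U(2) U(1)[OF H_P] by (intro emeasure_mono) blast+
  finally have "\<delta> * prob (\<Union>H) \<le> prob (T \<inter> U)"
    using assms(3) by (simp add: emeasure_eq_measure ennreal_mult[symmetric])
  then have "prob (\<Union>H) \<le> prob (T \<inter> U) / \<delta>" using assms(3) by (simp add: field_simps)
  moreover have "\<Union>H \<in> sets M" using H_countable H_sets by (intro sets.countable_Union) auto
  moreover have "A \<subseteq> \<Union>H"
    using A(1) by (auto simp: H_def cylinder_def)
  ultimately show ?thesis by blast
qed

text \<open>An instance of Levy's zero-one law. The complement of finitely many of the sets \<open>T i\<close> is a
  union of cylinders, and this open set can be chosen to meet \<open>\<Union>i. T i\<close> in a set of small
  probability.\<close>

lemma levy_zero_one:
  assumes T: "\<And>i. T i \<in> sets M"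
    and closed: "\<And>i \<omega>. \<omega> \<in> space M - T i \<Longrightarrow> \<exists>n. cylinder X (\<lambda>k. X k \<omega>) n \<inter> T i = {}"
    and \<delta>: "0 < \<delta>"
  shows "AE \<omega> in M. (\<exists>\<^sub>\<infinity>n. \<delta> * prob (cylinder X (\<lambda>k. X k \<omega>) n)
      \<le> prob ((\<Union>i::nat. T i) \<inter> cylinder X (\<lambda>k. X k \<omega>) n)) \<longrightarrow> \<omega> \<in> (\<Union>i. T i)"
proof -
  let ?cyl = "\<lambda>\<omega> n. cylinder X (\<lambda>k. X k \<omega>) n"
  define TT where "TT = (\<Union>i. T i)"
  have TT: "TT \<in> sets M" using T by (auto simp: TT_def)
  define Q where "Q C \<longleftrightarrow> \<delta> * prob C \<le> prob (TT \<inter> C)" for C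
  \<comment> \<open>This is the exceptional set; it will be shown to lie in a null set.\<close>
  define A where "A = {\<omega> \<in> space M. (\<exists>\<^sub>\<infinity>n. Q (?cyl \<omega> n)) \<and> \<omega> \<notin> TT}"
  define T' where "T' J = (\<Union>i<J. T i)" for J
  have T': "T' J \<in> sets M" for J using T by (auto simp: T'_def)
  have "\<exists>B\<in>sets M. A \<subseteq> B \<and> prob B \<le> prob (TT \<inter> (space M - T' J)) / \<delta>" for J
  proof (rule cylinder_cover[where P = "\<lambda>C. Q C \<and> C \<subseteq> space M - T' J"])
    fix \<omega> assume \<omega>: "\<omega> \<in> A"
    then have "\<forall>i. \<exists>n. ?cyl \<omega> n \<inter> T i = {}" using closed by (auto simp: A_def TT_def)
    then obtain N where N: "?cyl \<omega> (N i) \<inter> T i = {}" for i by metis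
    \<comment> \<open>The sum dominates each \<open>N i\<close>, so the cylinder at this later time
      \<open>n\<close> avoids all of the first \<open>J\<close> sets at once.\<close>
    obtain n where n: "(\<Sum>i<J. N i) < n" "Q (?cyl \<omega> n)"
      using \<omega> unfolding A_def INFM_nat by blast
    have "?cyl \<omega> n \<inter> T i = {}" if "i < J" for i
    proof -
      have "N i \<le> n" using member_le_sum[of i "{..<J}" N] that n(1) by simp
      then show ?thesis using N[of i] cylinder_antimono[of "N i" n X] by blast
    qed
    then have "?cyl \<omega> n \<subseteq> space M - T' J" by (auto simp: T'_def cylinder_def)
    then show "\<exists>n. Q (?cyl \<omega> n) \<and> ?cyl \<omega> n \<subseteq> space M - T' J" using n(2) by blast
  qed (use TT T' \<delta> in \<open>auto simp: Q_def A_def\<close>)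
  then obtain B where B: "\<And>J. B J \<in> sets M" "\<And>J. A \<subseteq> B J"
    "\<And>J. prob (B J) \<le> prob (TT \<inter> (space M - T' J)) / \<delta>" by metis
  \<comment> \<open>The sets decrease to the empty set, because each point of the union already lies
    in some \<open>T' J\<close>.\<close>
  have lim: "(\<lambda>J. prob (TT \<inter> (space M - T' J))) \<longlonglongrightarrow> 0"
  proof -
    have "(\<lambda>J. prob (TT \<inter> (space M - T' J))) \<longlonglongrightarrow> prob (\<Inter>J. TT \<inter> (space M - T' J))"
      using TT T' by (intro finite_Lim_measure_decseq) (auto simp: decseq_def T'_def)
    moreover have "(\<Inter>J. TT \<inter> (space M - T' J)) = {}"
      by (auto simp: TT_def T'_def)
    ultimately show ?thesis by simp
  qed
  have "prob (\<Inter>J. B J) \<le> prob (TT \<inter> (space M - T' J)) / \<delta>" for J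
    using B(1) B(3)[of J] by (intro order_trans[OF finite_measure_mono B(3)]) auto
  moreover have "(\<lambda>J. prob (TT \<inter> (space M - T' J)) / \<delta>) \<longlonglongrightarrow> 0"
    using tendsto_divide[OF lim tendsto_const[of \<delta>]] \<delta> by simp
  ultimately have "prob (\<Inter>J. B J) \<le> 0" by (intro LIMSEQ_le_const) auto
  then have "(\<Inter>J. B J) \<in> null_sets M"
    using B(1) by (intro null_setsI) (auto simp: emeasure_eq_measure measure_le_0_iff)
  then have "AE \<omega> in M. \<omega> \<notin> (\<Inter>J. B J)" by (rule AE_not_in)
  with AE_space show ?thesis
  proof eventually_elim
    case (elim \<omega>)
    then have "\<omega> \<notin> A" using B(2) by blast
    with elim(1) show ?case unfolding A_def Q_def TT_def by blast
  qed
qed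

end

end

subsection \<open>Trapping probabilities\<close>

text \<open>These are the common features of finite graphs and the lattice: a degree bound uniform
  in the vertex, and from each vertex an infinite walk that ends up circling, ready to be appended
  to any history.\<close>

locale ant_rw_graph = ant_rw G \<beta> v M X + symmetric_graph G
  for G :: "'v pair_pre_digraph" and \<beta> :: real and v :: 'v
    and M :: "'w measure" and X :: "nat \<Rightarrow> 'w \<Rightarrow> 'v" +
  fixes D :: nat
  assumes \<beta>_pos: "0 < \<beta>"
    and countable_pverts: "countable (pverts G)"
    and card_neighbours: "card (neighbours G x) \<le> D"
    and to_circuit: "x \<in> pverts G \<Longrightarrow> \<exists>w d C. w 0 = x \<and> (\<forall>k. (w k, w (Suc k)) \<in> parcs G) \<and>
      C \<in> circuits G \<and> follows w d C"
begin

section \<open>Measurability and conditional one-step probabilities\<close>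

lemmas [measurable] = eq_sets[OF countable_pverts random_variable]
lemmas cyl_sets [measurable] = cylinder_sets[OF countable_pverts random_variable]

abbreviation hist :: "nat \<Rightarrow> 'w measure" where
  "hist \<equiv> history M (pverts G) X"

lemma X_in_pverts: "\<omega> \<in> space M \<Longrightarrow> X n \<omega> \<in> pverts G"
  using measurable_space[OF random_variable] by simp

lemma neighbours_nonempty: "x \<in> pverts G \<Longrightarrow> neighbours G x \<noteq> {}"
  using to_circuit[of x] unfolding neighbours_def by (metis empty_iff mem_Collect_eq)

lemma neighbours_in_pverts: "neighbours G x \<subseteq> pverts G"
  using sym in_pverts unfolding neighbours_def by blast

lemma space_hist: "space (hist n) = space M"
  by (auto simp: history_def intro!: space_measure_of)

lemma sets_hist: "sets (hist n) = sigma_sets (space M) {X k -` A \<inter> space M | k A. k \<le> n \<and> A \<subseteq> pverts G}"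
  unfolding history_def by (intro sets_measure_of) auto

lemma subalgebra_hist: "subalgebra M (hist n)"
  unfolding subalgebra_def space_hist sets_hist
proof (intro conjI refl sets.sigma_sets_subset)
  show "{X k -` A \<inter> space M | k A. k \<le> n \<and> A \<subseteq> pverts G} \<subseteq> sets M"
    using random_variable by (auto intro!: measurable_sets)
qed

lemma eq_in_hist:
  assumes "k \<le> n"
  shows "{\<omega> \<in> space M. X k \<omega> = x} \<in> sets (hist n)"
proof (cases "x \<in> pverts G")
  case True
  have "{\<omega> \<in> space M. X k \<omega> = x} = X k -` {x} \<inter> space M" by auto
  then show ?thesis unfolding sets_hist using True assms by (intro sigma_sets.Basic) blast
next
  case False
  then have "{\<omega> \<in> space M. X k \<omega> = x} = {}" using X_in_pverts by blast
  then show ?thesis by (simp only: sets.empty_sets)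
qed

lemma cylinder_in_hist: "cylinder X p n \<in> sets (hist n)"
proof -
  have "cylinder X p n = (\<Inter>k\<le>n. {\<omega> \<in> space M. X k \<omega> = p k})"
    by (auto simp: cylinder_def)
  also have "\<dots> \<in> sets (hist n)"
    using eq_in_hist by (intro sets.finite_INT) auto
  finally show ?thesis .
qed

abbreviation cond_prob_step :: "nat \<Rightarrow> 'v \<Rightarrow> 'w \<Rightarrow> real" where
  "cond_prob_step n x \<equiv> real_cond_exp M (hist n) (indicator {\<omega> \<in> space M. X (Suc n) \<omega> = x})"

lemma sigma_finite_hist: "sigma_finite_subalgebra M (hist n)"
  by (intro finite_measure_subalgebra_is_sigma_finite finite_measure_subalgebra.intro
      finite_measure_subalgebra_axioms.intro subalgebra_hist finite_measure_axioms)

lemma prob_step: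
  assumes "A \<in> sets (hist n)"
  shows "integrable M (\<lambda>\<omega>. indicator A \<omega> * cond_prob_step n x \<omega>)"
    and "prob (A \<inter> {\<omega> \<in> space M. X (Suc n) \<omega> = x})
      = (\<integral>\<omega>. indicator A \<omega> * cond_prob_step n x \<omega> \<partial>M)"
proof -
  interpret S: sigma_finite_subalgebra M "hist n" by (rule sigma_finite_hist)
  let ?E = "{\<omega> \<in> space M. X (Suc n) \<omega> = x}"
  have A: "A \<in> sets M" using assms subalgebra_hist[of n] by (auto simp: subalgebra_def)
  have int: "integrable M (indicator ?E :: 'w \<Rightarrow> real)"
    by (intro integrable_real_indicator) (auto simp: emeasure_eq_measure)
  show "integrable M (\<lambda>\<omega>. indicator A \<omega> * cond_prob_step n x \<omega>)"
    using integrable_mult_indicator[OF A S.real_cond_exp_int(1)[OF int]] by simp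
  have "prob (A \<inter> ?E) = (\<integral>\<omega>. indicator (A \<inter> ?E) \<omega> \<partial>M)"
    using A by (simp add: Int_absorb2 sets.sets_into_space)
  also have "\<dots> = (\<integral>\<omega>\<in>A. indicator ?E \<omega> \<partial>M)"
    by (simp add: set_lebesgue_integral_def indicator_inter_arith)
  also have "\<dots> = (\<integral>\<omega>\<in>A. cond_prob_step n x \<omega> \<partial>M)"
    by (intro S.real_cond_exp_intA int assms)
  finally show "prob (A \<inter> ?E) = (\<integral>\<omega>. indicator A \<omega> * cond_prob_step n x \<omega> \<partial>M)"
    by (simp add: set_lebesgue_integral_def)
qed

section \<open>Transition probabilities along cylinders\<close>

definition step_prob :: "(nat \<Rightarrow> 'v) \<Rightarrow> nat \<Rightarrow> 'v \<Rightarrow> real" where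
  "step_prob p n x = ant_weight \<beta> p n (p n) x / (\<Sum>y\<in>neighbours G (p n). ant_weight \<beta> p n (p n) y)"

lemma sum_weight_pos:
  "x \<in> pverts G \<Longrightarrow> 0 < (\<Sum>y\<in>neighbours G x. ant_weight \<beta> p n x y)"
  using finite_neighbours neighbours_nonempty by (intro sum_pos) (auto simp: ant_weight_def)

text \<open>The conditional probability of the next step depends only on the positions up to time
  \<open>n\<close>, so it is almost surely constant on the cylinder and can be pulled out of the
  integral.\<close>

lemma prob_cylinder_Suc:
  assumes "p (Suc n) \<in> neighbours G (p n)"
  shows "prob (cylinder X p (Suc n)) = step_prob p n (p (Suc n)) * prob (cylinder X p n)"
proof -
  let ?x = "p (Suc n)"
  have eq: "step_prob (\<lambda>k. X k \<omega>) n ?x = step_prob p n ?x" if "\<omega> \<in> cylinder X p n" for \<omega>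
  proof -
    have "crossing_number (\<lambda>k. X k \<omega>) n = crossing_number p n"
      using that by (intro crossing_number_cong) (simp add: cylinder_def)
    then show ?thesis using that by (simp add: step_prob_def ant_weight_def cylinder_def)
  qed
  have "?x \<in> pverts G" using assms neighbours_in_pverts by blast
  have "cylinder X p (Suc n) = cylinder X p n \<inter> {\<omega> \<in> space M. X (Suc n) \<omega> = ?x}"
    by (auto simp: cylinder_def le_Suc_eq)
  then have "prob (cylinder X p (Suc n))
      = (\<integral>\<omega>. indicator (cylinder X p n) \<omega> * cond_prob_step n ?x \<omega> \<partial>M)"
    using prob_step(2)[OF cylinder_in_hist] by simp
  also have "\<dots> = (\<integral>\<omega>. indicator (cylinder X p n) \<omega> * step_prob p n ?x \<partial>M)"
  proof (intro integral_cong_AE)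
    show "AE \<omega> in M. indicator (cylinder X p n) \<omega> * cond_prob_step n ?x \<omega>
        = indicator (cylinder X p n) \<omega> * step_prob p n ?x"
      using transition[OF \<open>?x \<in> pverts G\<close>, of n]
    proof eventually_elim
      case (elim \<omega>)
      show ?case
      proof (cases "\<omega> \<in> cylinder X p n")
        case True
        then have "X n \<omega> = p n" by (simp add: cylinder_def)
        then show ?thesis using elim eq[OF True] assms True by (simp add: step_prob_def)
      qed simp
    qed
    show "(\<lambda>\<omega>. indicator (cylinder X p n) \<omega> * cond_prob_step n ?x \<omega>) \<in> borel_measurable M"
      using prob_step(1)[OF cylinder_in_hist] by (rule borel_measurable_integrable)
  qed measurable
  also have "\<dots> = step_prob p n ?x * prob (cylinder X p n)"
    using cyl_sets by (simp add: Int_absorb2 sets.sets_into_space mult.commute)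
  finally show ?thesis .
qed

text \<open>The transition law speaks only of neighbours of the current vertex. Their conditional
  probabilities already sum to 1, which leaves no mass for any other vertex.\<close>

lemma AE_path: "AE \<omega> in M. \<forall>n. (X n \<omega>, X (Suc n) \<omega>) \<in> parcs G"
proof -
  have "AE \<omega> in M. X n \<omega> = y \<longrightarrow> (X n \<omega>, X (Suc n) \<omega>) \<in> parcs G" if y: "y \<in> pverts G" for n y
  proof -
    let ?A = "{\<omega> \<in> space M. X n \<omega> = y}"
    let ?E = "\<lambda>x. {\<omega> \<in> space M. X (Suc n) \<omega> = x}"
    have A: "?A \<in> sets (hist n)" by (intro eq_in_hist) simp
    have meas: "?A \<in> sets M" "\<And>x. ?E x \<in> sets M" by measurable
    have "prob (\<Union>x\<in>neighbours G y. ?A \<inter> ?E x) = (\<Sum>x\<in>neighbours G y. prob (?A \<inter> ?E x))"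
      using finite_neighbours meas
      by (intro finite_measure_finite_Union) (auto simp: disjoint_family_on_def)
    also have "\<dots> = (\<integral>\<omega>. (\<Sum>x\<in>neighbours G y. indicator ?A \<omega> * cond_prob_step n x \<omega>) \<partial>M)"
      using prob_step[OF A] by (subst Bochner_Integration.integral_sum) auto
    also have "\<dots> = (\<integral>\<omega>. indicator ?A \<omega> \<partial>M)"
    proof (intro integral_cong_AE)
      have "AE \<omega> in M. \<forall>x\<in>neighbours G y. x \<in> neighbours G (X n \<omega>) \<longrightarrow>
          cond_prob_step n x \<omega> = step_prob (\<lambda>k. X k \<omega>) n x"
        using transition neighbours_in_pverts finite_neighbours unfolding step_prob_def
        by (intro AE_finite_allI) auto
      then show "AE \<omega> in M. (\<Sum>x\<in>neighbours G y. indicator ?A \<omega> * cond_prob_step n x \<omega>)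
          = indicator ?A \<omega>"
      proof eventually_elim
        case (elim \<omega>)
        show ?case
        proof (cases "\<omega> \<in> ?A")
          case True
          then have "(\<Sum>x\<in>neighbours G y. indicator ?A \<omega> * cond_prob_step n x \<omega>)
              = (\<Sum>x\<in>neighbours G y. step_prob (\<lambda>k. X k \<omega>) n x)"
            using elim by (intro sum.cong) auto
          also have "\<dots> = 1"
            using sum_weight_pos[OF y, of "\<lambda>k. X k \<omega>" n] True
            by (simp add: step_prob_def sum_divide_distrib[symmetric])
          finally show ?thesis using True by simp
        qed simp
      qed
      show "(\<lambda>\<omega>. \<Sum>x\<in>neighbours G y. indicator ?A \<omega> * cond_prob_step n x \<omega>) \<in> borel_measurable M"
        using prob_step(1)[OF A] by (intro borel_measurable_sum borel_measurable_integrable)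
    qed (use meas in simp)
    also have "\<dots> = prob ?A" using meas by (simp add: Int_absorb2 sets.sets_into_space)
    finally have eq: "prob (\<Union>x\<in>neighbours G y. ?A \<inter> ?E x) = prob ?A" .
    have U: "(\<Union>x\<in>neighbours G y. ?A \<inter> ?E x) \<in> sets M"
      by (intro sets.finite_UN finite_neighbours sets.Int meas)
    have "prob (?A - (\<Union>x\<in>neighbours G y. ?A \<inter> ?E x)) = 0"
      unfolding finite_measure_Diff[OF meas(1) U UN_least[OF Int_lower1]] eq by simp
    then have "?A - (\<Union>x\<in>neighbours G y. ?A \<inter> ?E x) \<in> null_sets M"
      using sets.Diff[OF meas(1) U] unfolding null_sets_def
      by (simp del: UN_simps add: emeasure_eq_measure)
    from AE_space AE_not_in[OF this] show ?thesis
      by eventually_elim (auto simp: neighbours_def)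
  qed
  then have "AE \<omega> in M. \<forall>n. \<forall>y\<in>pverts G. X n \<omega> = y \<longrightarrow> (X n \<omega>, X (Suc n) \<omega>) \<in> parcs G"
    unfolding AE_all_countable AE_ball_countable[OF countable_pverts] by blast
  with AE_space show ?thesis by eventually_elim (use X_in_pverts in auto)
qed

text \<open>Each of at most \<open>D\<close> competitors weighs at most
  \<open>exp (\<beta> * d)\<close> times as much as the chosen edge, so the step has probability at
  least \<open>1 / (1 + D * exp (\<beta> * d))\<close>. The weaker exponential form turns products
  over steps into sums of exponents.\<close>

lemma step_prob_ge:
  assumes "p (Suc n) \<in> neighbours G (p n)" "step_slack G p n d"
  shows "exp (- (D * exp (\<beta> * d))) \<le> step_prob p n (p (Suc n))"
proof -
  let ?N = "neighbours G (p n)" and ?z = "p (Suc n)"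
  let ?w = "ant_weight \<beta> p n (p n)"
  have w_pos: "0 < ?w y" for y by (simp add: ant_weight_def)
  have "(\<Sum>y\<in>?N. ?w y) = ?w ?z + (\<Sum>y\<in>?N - {?z}. ?w y)"
    using assms(1) finite_neighbours by (simp add: sum.remove)
  also have "(\<Sum>y\<in>?N - {?z}. ?w y) \<le> (\<Sum>y\<in>?N - {?z}. ?w ?z * exp (\<beta> * d))"
  proof (intro sum_mono)
    fix y assume "y \<in> ?N - {?z}"
    then have "crossing_number p n (p n) y \<le> crossing_number p n (p n) ?z + d"
      using assms(2) by (simp add: step_slack_def)
    then have "real_of_int (crossing_number p n (p n) y) \<le> crossing_number p n (p n) ?z + d"
      by linarith
    then have "\<beta> * crossing_number p n (p n) y \<le> \<beta> * (crossing_number p n (p n) ?z + d)"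
      using \<beta>_pos by (intro mult_left_mono) auto
    then show "?w y \<le> ?w ?z * exp (\<beta> * d)"
      by (simp add: ant_weight_def exp_add[symmetric] distrib_left)
  qed
  also have "\<dots> = card (?N - {?z}) * (?w ?z * exp (\<beta> * d))" by simp
  also have "\<dots> \<le> D * (?w ?z * exp (\<beta> * d))"
  proof (intro mult_right_mono)
    have "card (?N - {?z}) \<le> card ?N" using finite_neighbours by (intro card_mono) auto
    then show "real (card (?N - {?z})) \<le> D" using card_neighbours[of "p n"] by linarith
  qed (use w_pos[of ?z] in simp)
  finally have "(\<Sum>y\<in>?N. ?w y) \<le> ?w ?z * (1 + D * exp (\<beta> * d))"
    by (simp add: algebra_simps)
  also have "\<dots> \<le> ?w ?z * exp (D * exp (\<beta> * d))"
    using w_pos[of ?z] exp_ge_add_one_self by (intro mult_left_mono) auto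
  finally have "(\<Sum>y\<in>?N. ?w y) * exp (- (D * exp (\<beta> * d))) \<le> ?w ?z"
    by (simp add: exp_minus field_simps)
  moreover have "0 < (\<Sum>y\<in>?N. ?w y)"
    using assms(1) sum_weight_pos in_pverts by (simp add: neighbours_def)
  ultimately show ?thesis by (simp add: step_prob_def field_simps)
qed

lemma prob_cylinder_ge:
  assumes "\<And>i. i < j \<Longrightarrow> (p (n + i), p (Suc (n + i))) \<in> parcs G \<and> step_slack G p (n + i) (d i)"
  shows "exp (- (\<Sum>i<j. D * exp (\<beta> * d i))) * prob (cylinder X p n) \<le> prob (cylinder X p (n + j))"
  using assms
proof (induction j)
  case (Suc j)
  have nb: "p (Suc (n + j)) \<in> neighbours G (p (n + j))"
    using Suc.prems by (simp add: neighbours_def)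
  have "exp (- (\<Sum>i<Suc j. D * exp (\<beta> * d i))) * prob (cylinder X p n)
      = exp (- (D * exp (\<beta> * d j))) * (exp (- (\<Sum>i<j. D * exp (\<beta> * d i))) * prob (cylinder X p n))"
    by (simp add: exp_add[symmetric])
  also have "\<dots> \<le> step_prob p (n + j) (p (Suc (n + j))) * prob (cylinder X p (n + j))"
    using Suc step_prob_ge[OF nb] by (intro mult_mono) (auto intro: order_trans[OF exp_ge_zero])
  finally show ?case using prob_cylinder_Suc[OF nb] by simp
qed simp

section \<open>The trapping event and its conditional probability\<close>

abbreviation traps :: "'w set" where
  "traps \<equiv> \<Union>C\<in>circuits G. trapped M X C"

lemma countable_circuits: "countable (circuits G)"
  by (rule countable_subset[of _ "lists (pverts G)"])
    (use countable_pverts in \<open>auto simp: circuits_def\<close>)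

lemma trapped_from_sets: "trapped_from M X C m \<in> sets M"
  unfolding trapped_from_def using eq_sets[OF countable_pverts random_variable] by (intro sets.sets_Collect) auto

lemma traps_sets: "traps \<in> sets M"
  using countable_circuits trapped_from_sets unfolding trapped_def
  by (intro sets.countable_UN'') auto

text \<open>The exponent adds the cost of \<open>K\<close> steering steps of slack 1 to that of
  circling forever on a circuit of length \<open>l\<close>, where the cost per round decays
  geometrically with ratio \<open>exp (- \<beta>)\<close>.\<close>

definition trap_bound :: "nat \<Rightarrow> nat \<Rightarrow> real" where
  "trap_bound K l = exp (- (D * (K * exp \<beta> + l / (1 - exp (- \<beta>)))))"

lemma trap_bound_antimono: "K \<le> K' \<Longrightarrow> l \<le> l' \<Longrightarrow> trap_bound K' l' \<le> trap_bound K l"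
  unfolding trap_bound_def using \<beta>_pos
  by (intro exp_mono le_imp_neg_le mult_left_mono add_mono mult_right_mono divide_right_mono) auto

text \<open>The costs of the steps round the circuit are summable, so the probabilities of following
  it for \<open>j\<close> steps have a lower bound independent of \<open>j\<close>. Continuity from
  above transfers the bound to following it forever.\<close>

lemma prob_traps_ge:
  assumes path: "\<And>k. (p k, p (Suc k)) \<in> parcs G" and nm: "n \<le> m"
    and slack: "\<And>k. n \<le> k \<Longrightarrow> k < m \<Longrightarrow> step_slack G p k 1"
    and C: "greedy_circuit G p m C"
  shows "trap_bound (m - n) (length C) * prob (cylinder X p n) \<le> prob (traps \<inter> cylinder X p n)"
proof -
  let ?l = "length C" and ?B = "D * (length C / (1 - exp (- \<beta>)))"
  have l: "0 < ?l" using C circuitsD(1)[of C G] by (auto simp: greedy_circuit_def)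
  have e: "exp (- \<beta>) < 1" using \<beta>_pos by simp
  have bound: "(\<Sum>i<j. D * exp (\<beta> * of_int (- int (i div ?l)))) \<le> ?B" for j
  proof -
    let ?f = "\<lambda>i. exp (\<beta> * real_of_int (- int (i div ?l)))"
    \<comment> \<open>Enlarging the range to \<open>j\<close> full rounds only adds positive terms,
      and round \<open>k\<close> consists of \<open>length C\<close> terms equal to
      \<open>exp (- \<beta>) ^ k\<close>.\<close>
    have "j \<le> j * ?l" using l by (cases ?l) auto
    then have "(\<Sum>i<j. ?f i) \<le> (\<Sum>i<j * ?l. ?f i)" by (intro sum_mono2) auto
    also have "\<dots> = (\<Sum>k<j. sum ?f {k * ?l..<k * ?l + ?l})"
      by (rule sum.nat_group[symmetric])
    also have "\<dots> = (\<Sum>k<j. ?l * exp (- \<beta>) ^ k)"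
    proof (intro sum.cong refl)
      fix k
      have "i div ?l = k" if "i \<in> {k * ?l..<k * ?l + ?l}" for i
        using that by (intro div_nat_eqI) (auto simp: mult.commute)
      then have "sum ?f {k * ?l..<k * ?l + ?l} = (\<Sum>i\<in>{k * ?l..<k * ?l + ?l}. exp (\<beta> * - k))"
        by (intro sum.cong) auto
      also have "\<dots> = ?l * exp (- \<beta>) ^ k"
        by (simp add: exp_of_nat_mult[symmetric] mult.commute)
      finally show "sum ?f {k * ?l..<k * ?l + ?l} = ?l * exp (- \<beta>) ^ k" .
    qed
    also have "\<dots> = ?l * (\<Sum>k<j. exp (- \<beta>) ^ k)" by (simp add: sum_distrib_left)
    also have "\<dots> \<le> ?l * (\<Sum>k. exp (- \<beta>) ^ k)"
      using e by (intro mult_left_mono sum_le_suminf summable_geometric) auto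
    also have "\<dots> = ?l / (1 - exp (- \<beta>))" using e by (simp add: suminf_geometric)
    finally have "D * (\<Sum>i<j. ?f i) \<le> ?B" by (intro mult_left_mono) auto
    then show ?thesis by (simp only: sum_distrib_left)
  qed
  have "exp (- ?B) * prob (cylinder X p m) \<le> prob (cylinder X p (m + j))" for j
  proof -
    have "exp (- ?B) * prob (cylinder X p m)
        \<le> exp (- (\<Sum>i<j. D * exp (\<beta> * of_int (- int (i div ?l))))) * prob (cylinder X p m)"
      using bound[of j] by (intro mult_right_mono) auto
    also have "\<dots> \<le> prob (cylinder X p (m + j))"
      using greedy_circuit_step_slack[OF C] path by (intro prob_cylinder_ge) auto
    finally show ?thesis .
  qed
  moreover have "(\<lambda>j. prob (cylinder X p (m + j))) \<longlonglongrightarrow> prob (\<Inter>j. cylinder X p (m + j))"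
    using cyl_sets cylinder_antimono[of _ _ X p]
    by (intro finite_Lim_measure_decseq) (auto simp: decseq_def)
  ultimately have "exp (- ?B) * prob (cylinder X p m) \<le> prob (\<Inter>j. cylinder X p (m + j))"
    by (intro LIMSEQ_le_const) auto
  also have "\<dots> \<le> prob (traps \<inter> cylinder X p n)"
  proof (intro finite_measure_mono)
    have "C ! (i mod length C) = p (m + i)" for i
      using C by (simp add: greedy_circuit_def follows_def)
    then have "(\<Inter>j. cylinder X p (m + j)) \<subseteq> trapped_from M X C m"
      by (auto simp: trapped_from_def cylinder_def)
    moreover have "(\<Inter>j. cylinder X p (m + j)) \<subseteq> cylinder X p n"
      using cylinder_antimono[OF nm, of X p] by (metis INT_lower UNIV_I add.right_neutral order_trans)
    ultimately show "(\<Inter>j. cylinder X p (m + j)) \<subseteq> traps \<inter> cylinder X p n"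
      using C unfolding greedy_circuit_def trapped_def by blast
  qed (use traps_sets cyl_sets in auto)
  finally have *: "exp (- ?B) * prob (cylinder X p m) \<le> prob (traps \<inter> cylinder X p n)" .
  have "exp (- ((m - n) * (D * exp \<beta>))) * prob (cylinder X p n) \<le> prob (cylinder X p m)"
    using prob_cylinder_ge[of "m - n" p n "\<lambda>_. 1"] path slack nm by simp
  then have "exp (- ?B) * (exp (- ((m - n) * (D * exp \<beta>))) * prob (cylinder X p n))
      \<le> exp (- ?B) * prob (cylinder X p m)" by (intro mult_left_mono) auto
  also note *
  finally have "exp (- ?B) * exp (- ((m - n) * (D * exp \<beta>))) * prob (cylinder X p n)
      \<le> prob (traps \<inter> cylinder X p n)" by (simp only: mult.assoc)
  moreover have "trap_bound (m - n) ?l = exp (- ?B) * exp (- ((m - n) * (D * exp \<beta>)))"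
    unfolding trap_bound_def exp_add[symmetric] by (rule arg_cong[of _ _ exp]) (simp add: algebra_simps)
  ultimately show ?thesis by simp
qed

text \<open>Enumerating the pairs of a circuit and a starting time makes \<open>traps\<close> a
  countable union of events whose failure is visible at a finite time, as
  \<open>levy_zero_one\<close> demands.\<close>

lemma AE_traps_if_often:
  assumes "0 < \<delta>"
  shows "AE \<omega> in M. (\<exists>\<^sub>\<infinity>n. \<delta> * prob (cylinder X (\<lambda>k. X k \<omega>) n)
      \<le> prob (traps \<inter> cylinder X (\<lambda>k. X k \<omega>) n)) \<longrightarrow> \<omega> \<in> traps"
proof -
  define I where "I = circuits G \<times> (UNIV :: nat set)"
  have "I \<noteq> {}" using not_empty X_in_pverts to_circuit unfolding I_def by blast
  moreover have "countable I" using countable_circuits by (simp add: I_def)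
  ultimately have range: "range (from_nat_into I) = I" by (rule range_from_nat_into)
  define T where "T i = (case from_nat_into I i of (C, m) \<Rightarrow> trapped_from M X C m)" for i
  have "(\<Union>i. T i) = (\<Union>(C, m)\<in>range (from_nat_into I). trapped_from M X C m)"
    by (auto simp: T_def)
  also have "\<dots> = traps" unfolding range by (auto simp: I_def trapped_def)
  finally have T: "(\<Union>i. T i) = traps" .
  show ?thesis unfolding T[symmetric]
  proof (rule levy_zero_one[OF countable_pverts random_variable])
    fix i
    obtain C m where Cm: "T i = trapped_from M X C m" by (metis T_def case_prod_conv surj_pair)
    then show "T i \<in> sets M" using trapped_from_sets by simp
    fix \<omega> assume "\<omega> \<in> space M - T i"
    then obtain k where "X (m + k) \<omega> \<noteq> C ! (k mod length C)"
      using Cm by (auto simp: trapped_from_def)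
    then have "cylinder X (\<lambda>k. X k \<omega>) (m + k) \<inter> T i = {}"
      using Cm by (auto simp: trapped_from_def cylinder_def)
    then show "\<exists>n. cylinder X (\<lambda>k. X k \<omega>) n \<inter> T i = {}" by blast
  qed (rule assms)
qed

text \<open>The lower bound depends on the trajectory only through its range \<open>F\<close>. There
  are countably many finite sets \<open>F\<close>, so the exceptional null sets can be
  united.\<close>

lemma AE_traps_if_finite_range: "AE \<omega> in M. finite (range (\<lambda>n. X n \<omega>)) \<longrightarrow> \<omega> \<in> traps"
proof -
  from to_circuit obtain w d C where w: "\<And>x. x \<in> pverts G \<Longrightarrow> w x 0 = x \<and>
      (\<forall>k. (w x k, w x (Suc k)) \<in> parcs G) \<and> C x \<in> circuits G \<and> follows (w x) (d x) (C x)"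
    by metis
  \<comment> \<open>Summing over \<open>F\<close> dominates the length of the detour from whichever
    vertex of \<open>F\<close> is the current one.\<close>
  define L where "L F = (\<Sum>x\<in>F. d x + 2 * length (C x))" for F
  define \<delta> where "\<delta> F = trap_bound (2 * L F + card F) (L F + card F)" for F
  have "AE \<omega> in M. \<forall>F\<in>{F. finite F \<and> F \<subseteq> pverts G}.
      (\<exists>\<^sub>\<infinity>n. \<delta> F * prob (cylinder X (\<lambda>k. X k \<omega>) n)
        \<le> prob (traps \<inter> cylinder X (\<lambda>k. X k \<omega>) n)) \<longrightarrow> \<omega> \<in> traps"
    using countable_Collect_finite_subset[OF countable_pverts]
    by (subst AE_ball_countable)
      (blast, intro ballI AE_traps_if_often, simp add: \<delta>_def trap_bound_def)
  with AE_space AE_path show ?thesis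
  proof eventually_elim
    case (elim \<omega>)
    show ?case
    proof
      let ?p = "\<lambda>k. X k \<omega>"
      define F where "F = range ?p"
      assume "finite (range ?p)"
      then have F: "finite F" "F \<subseteq> pverts G" using X_in_pverts elim(1) by (auto simp: F_def)
      have "\<delta> F * prob (cylinder X ?p n) \<le> prob (traps \<inter> cylinder X ?p n)" for n
      proof -
        let ?x = "?p n"
        have x: "?x \<in> pverts G" "?x \<in> F" using X_in_pverts elim(1) by (auto simp: F_def)
        have card: "card (?p ` {..n}) \<le> card F" using F by (intro card_mono) (auto simp: F_def)
        have L: "d ?x + 2 * length (C ?x) \<le> L F"
          unfolding L_def using member_le_sum[of ?x F "\<lambda>x. d x + 2 * length (C x)"] x F by simp
        have path: "is_path ?p n" using elim(2) by blast
        have wx: "w ?x 0 = ?x" "\<And>k. (w ?x k, w ?x (Suc k)) \<in> parcs G"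
          "C ?x \<in> circuits G" "follows (w ?x) (d ?x) (C ?x)"
          using w[OF x(1)] by blast+
        obtain q m C' where q: "\<forall>k\<le>n. q k = ?p k" "\<forall>k. (q k, q (Suc k)) \<in> parcs G"
          "n \<le> m" "m \<le> n + 2 * (d ?x + 2 * length (C ?x)) + card (?p ` {..n})"
          "length C' \<le> d ?x + 2 * length (C ?x) + card (?p ` {..n})"
          "\<forall>k. n \<le> k \<longrightarrow> k < m \<longrightarrow> step_slack G q k 1" "greedy_circuit G q m C'"
          using greedy_circuit_extension[OF path wx] by (elim exE conjE)
        have cyl: "cylinder X q n = cylinder X ?p n" using q(1) by (intro cylinder_cong) simp
        have "\<delta> F * prob (cylinder X q n) \<le> trap_bound (m - n) (length C') * prob (cylinder X q n)"
          unfolding \<delta>_def using q(4,5) card L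
          by (intro mult_right_mono trap_bound_antimono) auto
        also have "\<dots> \<le> prob (traps \<inter> cylinder X q n)"
          using q by (intro prob_traps_ge) auto
        finally show ?thesis unfolding cyl .
      qed
      then show "\<omega> \<in> traps" using elim(3) F by auto
    qed
  qed
qed

text \<open>A fresh circuit rooted at the current position is greedy at once, by
  \<open>fresh_greedy_circuit\<close>. With no steering steps to pay for,
  \<open>trap_bound 0 l\<close> works at every such time.\<close>

lemma AE_traps_if_often_fresh:
  "AE \<omega> in M. (\<exists>\<^sub>\<infinity>n. \<exists>C\<in>circuits G. length C \<le> l \<and> hd C = X n \<omega> \<and>
     set C \<inter> (\<lambda>k. X k \<omega>) ` {..<n} = {}) \<longrightarrow> \<omega> \<in> traps"
proof -
  have "0 < trap_bound 0 l" by (simp add: trap_bound_def)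
  from AE_traps_if_often[OF this] AE_path show ?thesis
  proof eventually_elim
    case (elim \<omega>)
    let ?p = "\<lambda>k. X k \<omega>"
    have "trap_bound 0 l * prob (cylinder X ?p n) \<le> prob (traps \<inter> cylinder X ?p n)"
      if C: "C \<in> circuits G" "length C \<le> l" "hd C = X n \<omega>" "set C \<inter> ?p ` {..<n} = {}" for n C
    proof -
      have len: "3 \<le> length C" using circuitsD(1)[OF C(1)] .
      then have hd: "hd C = C ! 0" by (intro hd_conv_nth) auto
      define q where "q k = (if k < n then X k \<omega> else C ! ((k - n) mod length C))" for k
      have qp: "q k = X k \<omega>" if "k \<le> n" for k
        using that C(3) hd by (cases "k = n") (auto simp: q_def)
      have follows: "follows q n C" by (simp add: follows_def q_def)
      interpret circuit_path G q n C using C(1) follows by unfold_locales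
      have "set C \<inter> q ` {..<n} = {}" using C(4) by (auto simp: q_def)
      then have greedy: "greedy_circuit G q n C"
        using C(1) follows by (intro fresh_greedy_circuit)
      have path: "(q k, q (Suc k)) \<in> parcs G" for k
      proof (cases "k < n")
        case True
        then show ?thesis using elim(2) qp by simp
      next
        case False
        then show ?thesis using path_arc[of "k - n"] by simp
      qed
      have cyl: "cylinder X q n = cylinder X ?p n" using qp by (rule cylinder_cong)
      have "trap_bound 0 l * prob (cylinder X q n)
          \<le> trap_bound (n - n) (length C) * prob (cylinder X q n)"
        using C(2) by (intro mult_right_mono trap_bound_antimono) auto
      also have "\<dots> \<le> prob (traps \<inter> cylinder X q n)"
        using path greedy by (intro prob_traps_ge) auto
      finally show ?thesis unfolding cyl .
    qed
    then show ?case using elim(1) by (blast intro: INFM_mono)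
  qed
qed

lemma prob_traps_eq_1: "AE \<omega> in M. \<omega> \<in> traps \<Longrightarrow> prob traps = 1"
  using prob_eq_1[OF traps_sets] by simp

end

subsection \<open>Finite graphs and the integer lattice\<close>

lemma (in symmetric_graph) path_to_circuit:
  assumes C: "C \<in> circuits G" and reach: "(x, hd C) \<in> (parcs G)\<^sup>*"
  shows "\<exists>w d C. w 0 = x \<and> (\<forall>k. (w k, w (Suc k)) \<in> parcs G) \<and> C \<in> circuits G \<and> follows w d C"
proof -
  from reach obtain d where "(x, hd C) \<in> parcs G ^^ d" by (auto simp: rtrancl_power)
  then obtain f where f: "f 0 = x" "f d = hd C" "\<And>i. i < d \<Longrightarrow> (f i, f (Suc i)) \<in> parcs G"
    by (auto simp: relpow_fun_conv)
  have "C \<noteq> []" using circuitsD(1)[OF C] by auto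
  then have hd: "hd C = C ! 0" by (rule hd_conv_nth)
  define w where "w k = (if k < d then f k else C ! ((k - d) mod length C))" for k
  have follows: "follows w d C" by (simp add: follows_def w_def)
  interpret circuit_path G w d C using C follows by unfold_locales
  have wf: "w k = f k" if "k \<le> d" for k using that f(2) hd by (cases "k = d") (auto simp: w_def)
  have "(w k, w (Suc k)) \<in> parcs G" for k
  proof (cases "k < d")
    case True
    then show ?thesis using f(3) wf by simp
  next
    case False
    then show ?thesis using path_arc[of "k - d"] by simp
  qed
  moreover have "w 0 = x" using wf[of 0] f(1) by simp
  ultimately show ?thesis using C follows by blast
qed

text \<open>The first time at which \<open>f\<close> exceeds its maximum over the times up to
  \<open>N\<close> is a record after \<open>N\<close>.\<close>

lemma records_if_unbounded:
  fixes f :: "nat \<Rightarrow> int"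
  assumes "\<And>b. \<exists>n. b < f n"
  shows "\<exists>\<^sub>\<infinity>n. \<forall>k<n. f k < f n"
  unfolding INFM_nat
proof
  fix N
  define b where "b = Max (f ` {..N})"
  have b: "f k \<le> b" if "k \<le> N" for k using that by (auto simp: b_def)
  define n where "n = (LEAST n. b < f n)"
  have n: "b < f n" unfolding n_def using assms by (rule LeastI_ex)
  have "N < n" using b[of n] n by force
  moreover have "f k < f n" if "k < n" for k
    using not_less_Least[of k "\<lambda>n. b < f n"] that n unfolding n_def by linarith
  ultimately show "\<exists>n>N. \<forall>k<n. f k < f n" by blast
qed

lemma finite_int_box: "finite {z :: int ^ 'd::finite. \<forall>i. \<bar>z $ i\<bar> \<le> b}"
proof (rule finite_subset)
  show "{z :: int ^ 'd. \<forall>i. \<bar>z $ i\<bar> \<le> b} \<subseteq> vec_lambda ` (UNIV \<rightarrow>\<^sub>E {- b..b})"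
  proof
    fix z :: "int ^ 'd" assume "z \<in> {z. \<forall>i. \<bar>z $ i\<bar> \<le> b}"
    then have "vec_nth z \<in> UNIV \<rightarrow>\<^sub>E {- b..b}" by (auto simp: abs_le_iff) (metis minus_le_iff)
    then show "z \<in> vec_lambda ` (UNIV \<rightarrow>\<^sub>E {- b..b})"
      by (intro image_eqI[where x = "vec_nth z"]) simp_all
  qed
qed (simp add: finite_PiE)

section \<open>Squares and degrees in the integer lattice\<close>

lemma int_lattice_arc_iff:
  "(x, y) \<in> parcs int_lattice \<longleftrightarrow> (\<Sum>i\<in>UNIV. \<bar>x $ i - y $ i\<bar>) = 1"
  by (simp add: int_lattice_def)

lemma pverts_int_lattice [simp]: "pverts int_lattice = UNIV"
  by (simp add: int_lattice_def)

lemma int_lattice_arcI: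
  assumes "y = x + axis i s \<or> x = y + axis i s" "\<bar>s\<bar> = 1"
  shows "(x, y) \<in> parcs int_lattice"
proof -
  have "\<bar>x $ k - y $ k\<bar> = (if k = i then 1 else 0)" for k
    using assms by (auto simp: axis_def)
  then show ?thesis by (simp add: int_lattice_arc_iff)
qed

text \<open>The sign \<open>s\<close> lets the square extend from \<open>x\<close> in either sense
  of coordinate \<open>i\<close>. For \<open>j\<close> different from \<open>i\<close>, the other
  side leaves that coordinate unchanged.\<close>

definition lattice_square :: "int ^ 'd \<Rightarrow> 'd \<Rightarrow> int \<Rightarrow> 'd \<Rightarrow> (int ^ 'd) list" where
  "lattice_square x i s j = [x, x + axis i s, x + axis i s + axis j 1, x + axis j 1]"

lemma lattice_square_circuit:
  fixes x :: "int ^ 'd::finite"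
  assumes "i \<noteq> j" "\<bar>s\<bar> = 1"
  shows "lattice_square x i s j \<in> circuits int_lattice"
proof -
  have nz: "axis i s $ i = s" "axis i s $ j = 0" "axis j (1::int) $ i = 0" "axis j (1::int) $ j = 1" "s \<noteq> 0"
    using assms by (auto simp: axis_def)
  have ne: "a \<noteq> b" if "a $ i \<noteq> b $ i \<or> a $ j \<noteq> b $ j" for a b :: "int ^ 'd"
    using that by auto
  have "distinct (lattice_square x i s j)"
    unfolding lattice_square_def by (simp del: add_left_cancel add_cancel_right_right, intro conjI ne) (simp_all add: nz)
  moreover have "(lattice_square x i s j ! k, lattice_square x i s j ! Suc k) \<in> parcs int_lattice"
    if "Suc k < 4" for k
  proof -
    have "k = 0 \<or> k = 1 \<or> k = 2" using that by linarith
    then show ?thesis unfolding lattice_square_def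
      using int_lattice_arcI[of "x + axis i s" x i s] int_lattice_arcI[of "x + axis i s + axis j 1" "x + axis i s" j 1]
        int_lattice_arcI[of "x + axis j 1" "x + axis i s + axis j 1" i s] assms
        int_lattice_arcI[of x "x + axis i s" i s] int_lattice_arcI[of "x + axis i s" "x + axis i s + axis j 1" j 1]
        int_lattice_arcI[of "x + axis i s + axis j 1" "x + axis j 1" i s]
      by (auto simp: ac_simps numeral_2_eq_2)
  qed
  moreover have "(last (lattice_square x i s j), hd (lattice_square x i s j)) \<in> parcs int_lattice"
    using int_lattice_arcI[of x "x + axis j 1" j 1] by (simp add: lattice_square_def)
  ultimately show ?thesis
    unfolding circuits_def by (simp add: lattice_square_def)
qed

lemma lattice_square_ge:
  assumes "i \<noteq> j" "\<bar>s\<bar> = 1" "z \<in> set (lattice_square x i s j)"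
  shows "s * x $ i \<le> s * z $ i"
proof -
  have "s * s = 1" using assms(2) by (metis abs_mult_self_eq mult_1)
  then show ?thesis using assms by (auto simp: lattice_square_def axis_def distrib_left)
qed

text \<open>Neighbours lie in a translate of one fixed box, which gives a degree bound independent
  of \<open>x\<close>.\<close>

lemma finite_neighbours_int_lattice:
  "finite (neighbours (int_lattice :: (int ^ 'd::finite) pair_pre_digraph) x)"
  "card (neighbours (int_lattice :: (int ^ 'd::finite) pair_pre_digraph) x)
    \<le> card {z :: int ^ 'd. \<forall>i. \<bar>z $ i\<bar> \<le> 1}"
proof -
  let ?B = "{z :: int ^ 'd. \<forall>i. \<bar>z $ i\<bar> \<le> 1}"
  have sub: "neighbours int_lattice x \<subseteq> (+) x ` ?B"
  proof
    fix y assume "y \<in> neighbours int_lattice x"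
    then have "(\<Sum>i\<in>UNIV. \<bar>x $ i - y $ i\<bar>) = 1" by (simp add: neighbours_def int_lattice_arc_iff)
    then have "\<bar>(y - x) $ i\<bar> \<le> 1" for i
      using member_le_sum[of i UNIV "\<lambda>i. \<bar>x $ i - y $ i\<bar>"] by simp
    then have "y - x \<in> ?B" by simp
    moreover have "y = x + (y - x)" by simp
    ultimately show "y \<in> (+) x ` ?B" by (rule rev_image_eqI)
  qed
  show "finite (neighbours int_lattice x)"
    using sub finite_int_box[of 1] by (rule finite_subset[OF _ finite_imageI])
  have "card (neighbours int_lattice x) \<le> card ((+) x ` ?B)"
    using sub finite_int_box[of 1] by (intro card_mono) auto
  also have "\<dots> \<le> card ?B" by (intro card_image_le finite_int_box)
  finally show "card (neighbours int_lattice x) \<le> card ?B" .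
qed

lemma symmetric_graph_int_lattice: "symmetric_graph (int_lattice :: (int ^ 'd::finite) pair_pre_digraph)"
  by unfold_locales (auto simp: int_lattice_arc_iff finite_neighbours_int_lattice abs_minus_commute)

section \<open>The two classes of graphs\<close>

lemma prob_traps_finite_graph:
  assumes "0 < \<beta>" "pair_bidirected_digraph G" "Digraph_Component.connected (with_proj G)"
    "finite (pverts G)" "\<not> undirected_tree G" "ant_rw G \<beta> v M X"
  shows "measure M (\<Union>C\<in>circuits G. trapped M X C) = 1"
proof -
  interpret G: pair_bidirected_digraph G by fact
  interpret ant_rw G \<beta> v M X by fact
  have sub: "neighbours G x \<subseteq> pverts G" for x
    using G.in_arcsD2 by (auto simp: neighbours_def)
  interpret symmetric_graph G
  proof
    show "finite (neighbours G x)" for x using sub assms(4) by (rule finite_subset)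
    show "(x, x) \<notin> parcs G" for x using G.pair_no_loops by fastforce
    show "(y, x) \<in> parcs G" if "(x, y) \<in> parcs G" for x y
      using G.pair_sym_arcs that by (auto simp: symmetric_def sym_def)
  qed (rule G.in_arcsD1)
  obtain C where C: "C \<in> circuits G" using assms(3,5) by (auto simp: undirected_tree_def)
  have "C \<noteq> []" using circuitsD(1)[OF C] by auto
  then have hd: "hd C \<in> pverts G" using circuitsD(3)[OF C] by auto
  have reach: "(x, hd C) \<in> (parcs G)\<^sup>*" if "x \<in> pverts G" for x
  proof -
    \<comment> \<open>Connectedness of a digraph refers to its symmetric closure, which here is
      \<open>G\<close> itself.\<close>
    have "x \<rightarrow>\<^sup>*\<^bsub>with_proj (mk_symmetric (with_proj G))\<^esub> hd C"
      using assms(3) that hd by (auto simp: connected_def strongly_connected_def)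
    then have "(x, hd C) \<in> (parcs (mk_symmetric (with_proj G)))\<^sup>*"
      unfolding reachable_def by (auto dest: rtrancl_on_rtranclI)
    moreover have "parcs (mk_symmetric (with_proj G)) = parcs G"
      using sym by (auto simp: parcs_mk_symmetric)
    ultimately show ?thesis by simp
  qed
  interpret ant_rw_graph G \<beta> v M X "card (pverts G)"
  proof
    show "card (neighbours G x) \<le> card (pverts G)" for x using sub assms(4) by (intro card_mono)
    show "countable (pverts G)" using assms(4) by (rule countable_finite)
  qed (use assms(1) path_to_circuit[OF C] reach in blast)+
  have "AE \<omega> in M. \<omega> \<in> traps"
    using AE_traps_if_finite_range AE_space
  proof eventually_elim
    case (elim \<omega>)
    have "finite (range (\<lambda>n. X n \<omega>))"
      using X_in_pverts[OF elim(2)] by (intro finite_subset[OF _ assms(4)]) auto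
    with elim(1) show ?case by blast
  qed
  then show ?thesis by (rule prob_traps_eq_1)
qed

lemma prob_traps_int_lattice:
  fixes v :: "int ^ 'd::finite"
  assumes "0 < \<beta>" "2 \<le> CARD('d)" "ant_rw int_lattice \<beta> v M X"
  shows "measure M (\<Union>C\<in>circuits int_lattice. trapped M X C) = 1"
proof -
  let ?G = "int_lattice :: (int ^ 'd) pair_pre_digraph"
  interpret ant_rw ?G \<beta> v M X by fact
  interpret symmetric_graph ?G by (rule symmetric_graph_int_lattice)
  have other: "\<exists>j. i \<noteq> j" for i :: 'd
  proof (rule ccontr)
    assume "\<not> ?thesis"
    then have "UNIV = {i}" by auto
    then have "CARD('d) = 1" by (metis card_1_singleton_iff One_nat_def)
    then show False using assms(2) by simp
  qed
  interpret ant_rw_graph ?G \<beta> v M X "card {z :: int ^ 'd. \<forall>i. \<bar>z $ i\<bar> \<le> 1}"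
  proof
    fix x :: "int ^ 'd"
    obtain i j :: 'd where ij: "i \<noteq> j" using other by blast
    have "(x, hd (lattice_square x i 1 j)) \<in> (parcs ?G)\<^sup>*" by (simp add: lattice_square_def)
    then show "\<exists>w d C. w 0 = x \<and> (\<forall>k. (w k, w (Suc k)) \<in> parcs ?G) \<and> C \<in> circuits ?G \<and> follows w d C"
      using lattice_square_circuit[OF ij, of 1 x] by (intro path_to_circuit) auto
  qed (use assms(1) finite_neighbours_int_lattice(2) in auto)
  have "AE \<omega> in M. \<omega> \<in> traps"
    using AE_traps_if_finite_range AE_traps_if_often_fresh[of 4]
  proof eventually_elim
    case (elim \<omega>)
    show ?case
    \<comment> \<open>Either some coordinate is unbounded in the sense given by the sign
      \<open>s\<close>, or all coordinates are bounded and the range is finite.\<close>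
    proof (cases "\<exists>i s. \<bar>s\<bar> = 1 \<and> (\<forall>b. \<exists>n. b < s * X n \<omega> $ i)")
      case True
      then obtain i s where s: "\<bar>s\<bar> = 1" and unb: "\<And>b. \<exists>n. b < s * X n \<omega> $ i" by blast
      obtain j where ij: "i \<noteq> j" using other by blast
      have "\<exists>\<^sub>\<infinity>n. \<forall>k<n. s * X k \<omega> $ i < s * X n \<omega> $ i"
        using unb by (rule records_if_unbounded)
      then have "\<exists>\<^sub>\<infinity>n. \<exists>C\<in>circuits ?G. length C \<le> 4 \<and> hd C = X n \<omega> \<and>
          set C \<inter> (\<lambda>k. X k \<omega>) ` {..<n} = {}"
      proof (rule INFM_mono)
        fix n assume rec: "\<forall>k<n. s * X k \<omega> $ i < s * X n \<omega> $ i"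
        let ?C = "lattice_square (X n \<omega>) i s j"
        \<comment> \<open>At a record time every earlier position is strictly below the current
          level in direction \<open>s\<close>, while the square lies at or above it.\<close>
        have "set ?C \<inter> (\<lambda>k. X k \<omega>) ` {..<n} = {}"
          using lattice_square_ge[OF ij s, of _ "X n \<omega>"] rec by force
        then show "\<exists>C\<in>circuits ?G. length C \<le> 4 \<and> hd C = X n \<omega> \<and>
            set C \<inter> (\<lambda>k. X k \<omega>) ` {..<n} = {}"
          using lattice_square_circuit[OF ij s]
          by (intro bexI[of _ ?C]) (auto simp: lattice_square_def)
      qed
      then show ?thesis using elim(2) by blast
    next
      case False
      then have "\<exists>b. \<forall>n. s * X n \<omega> $ i \<le> b" if "\<bar>s\<bar> = 1" for i s
        using that by (meson not_less)
      from this[of 1] this[of "- 1"] have "\<forall>i. \<exists>b. \<forall>n. \<bar>X n \<omega> $ i\<bar> \<le> b"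
        by (simp add: abs_le_iff) (meson max.coboundedI1 max.coboundedI2)
      then obtain b where b: "\<And>i n. \<bar>X n \<omega> $ i\<bar> \<le> b i" by metis
      have "\<bar>X n \<omega> $ i\<bar> \<le> (\<Sum>i\<in>UNIV. \<bar>b i\<bar>)" for n i
        using b[of n i] member_le_sum[of i UNIV "\<lambda>i. \<bar>b i\<bar>"] by simp
      then have "range (\<lambda>n. X n \<omega>) \<subseteq> {z. \<forall>i. \<bar>z $ i\<bar> \<le> (\<Sum>i\<in>UNIV. \<bar>b i\<bar>)}" by blast
      then have "finite (range (\<lambda>n. X n \<omega>))" using finite_int_box by (rule finite_subset)
      then show ?thesis using elim(1) by blast
    qed
  qed
  then show ?thesis by (rule prob_traps_eq_1)
qed

theorem theorem2p2:
  fixes \<beta> :: real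
  assumes "0 < \<beta>"
  shows
    "(\<forall>(G :: 'v pair_pre_digraph) v (M :: 'w measure) X.
        pair_bidirected_digraph G \<and> Digraph_Component.connected (with_proj G) \<and>
        finite (pverts G) \<and> \<not> undirected_tree G \<and>
        v \<in> pverts G \<and> ant_rw G \<beta> v M X \<longrightarrow>
        measure M (\<Union>C\<in>circuits G. trapped M X C) = 1) \<and>
     (2 \<le> CARD('d::finite) \<longrightarrow>
       (\<forall>(v :: int ^ 'd) (M :: 'w measure) X.
          ant_rw int_lattice \<beta> v M X \<longrightarrow>
          measure M (\<Union>C\<in>circuits int_lattice. trapped M X C) = 1))"
proof (intro conjI allI impI)
  fix G :: "'v pair_pre_digraph" and v and M :: "'w measure" and X
  assume "pair_bidirected_digraph G \<and> Digraph_Component.connected (with_proj G) \<and>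
    finite (pverts G) \<and> \<not> undirected_tree G \<and> v \<in> pverts G \<and> ant_rw G \<beta> v M X"
  then show "measure M (\<Union>C\<in>circuits G. trapped M X C) = 1"
    by (elim conjE) (rule prob_traps_finite_graph[OF assms])
next
  fix v :: "int ^ 'd" and M :: "'w measure" and X
  assume "2 \<le> CARD('d)" "ant_rw int_lattice \<beta> v M X"
  then show "measure M (\<Union>C\<in>circuits int_lattice. trapped M X C) = 1"
    by (rule prob_traps_int_lattice[OF assms])
qed

end
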